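(* Let $m>1$, $p\mid m$, and $W=G(m,p,4)$. Nice $4$-tuples exist in $W$ if and only if $W$ is $G(2,2,4)$ or $G(4,4,4)$. Likewise, nice $5$-tuples exist in $W$ if and only if $W$ is $G(2,2,4)$ or $G(4,4,4)$.
   Context: $G(m,p,n)$ (with $p\mid m$) is the group of $n\times n$ complex generalized permutation matrices (exactly one nonzero entry in each row and each column) whose nonzero entries are $m$-th roots of unity and such that the product of all nonzero entries is an $(m/p)$-th root of unity. A reflection is an invertible matrix of finite order having exactly one eigenvalue different from $1$, of multiplicity $1$ (pseudo-reflections are allowed). A $T$-tuple $[A_1,\dots,A_T]$ of matrices in a finite complex reflection group $W\subset \mathrm{GL}_n(\mathbb C)$ (considered up to simultaneous conjugation) is called nice if: (1) every $A_i$ is a reflection in $W$; (2) $W=\langle A_1,\dots,A_T\rangle$; (3) $(A_1A_2\cdots A_T)^{-1}$ has an eigenvalue $\lambda\neq 1$ of multiplicity $T-2$ (exactly). *)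

theory Defs
  imports
    "Jordan_Normal_Form.Char_Poly"
    "HOL-Algebra.Generated_Groups"
begin

abbreviation GL :: "nat \<Rightarrow> complex mat monoid" where
  "GL n \<equiv> units_of (ring_mat TYPE(complex) n ())"

lemma group_GL: "group (GL n)"
  by (intro monoid.units_group ring.is_monoid ring_mat)

text \<open>
  The group $G(m,p,n)$, as a set of matrices (a subset of \<open>carrier (GL n)\<close>). It is meant
  for \<open>p dvd m\<close>, so that \<open>m div p\<close> is exact.
\<close>

definition Gmpn :: "nat \<Rightarrow> nat \<Rightarrow> nat \<Rightarrow> complex mat set" where
  "Gmpn m p n = {A \<in> carrier_mat n n.
     (\<forall>i<n. \<exists>!j. j < n \<and> A $$ (i, j) \<noteq> 0) \<and>
     (\<forall>j<n. \<exists>!i. i < n \<and> A $$ (i, j) \<noteq> 0) \<and>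
     (\<forall>i<n. \<forall>j<n. A $$ (i, j) \<noteq> 0 \<longrightarrow> A $$ (i, j) ^ m = 1) \<and>
     (\<Prod>x | x \<in> {..<n} \<times> {..<n} \<and> A $$ x \<noteq> 0. A $$ x) ^ (m div p) = 1}"

text \<open>
  Multiplicities of eigenvalues are algebraic. The two notions of multiplicity coincide for
  matrices of finite order, which are diagonalizable.
\<close>

definition eigenvalue_mult :: "complex mat \<Rightarrow> complex \<Rightarrow> nat" where
  "eigenvalue_mult A l = Polynomial.order l (char_poly A)"

definition is_reflection :: "nat \<Rightarrow> complex mat \<Rightarrow> bool" where
  "is_reflection n A \<longleftrightarrow>
     A \<in> carrier (GL n) \<and>
     (\<exists>k>0. A ^\<^sub>m k = 1\<^sub>m n) \<and>
     (\<exists>l. {u. eigenvalue A u \<and> u \<noteq> 1} = {l} \<and> eigenvalue_mult A l = 1)"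

text \<open>
  A tuple is a list; tuples are not identified up to simultaneous conjugation, which is
  immaterial for their existence. The truncated subtraction \<open>T - 2\<close> is harmless, since an
  eigenvalue has positive multiplicity: no tuple with \<open>T \<le> 2\<close> is nice.
\<close>

definition nice_tuple :: "nat \<Rightarrow> complex mat set \<Rightarrow> nat \<Rightarrow> complex mat list \<Rightarrow> bool" where
  "nice_tuple n W T As \<longleftrightarrow>
     length As = T \<and>
     (\<forall>A \<in> set As. A \<in> W \<and> is_reflection n A) \<and>
     generate (GL n) (set As) = W \<and>
     (let M = inv\<^bsub>GL n\<^esub> (foldr (*) As (1\<^sub>m n)) in
       \<exists>l. l \<noteq> 1 \<and> eigenvalue M l \<and> eigenvalue_mult M l = T - 2)"

end

theory Submission
  imports Defs "HOL-Library.Real_Mod"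
begin

text \<open>
  A reflection of \<open>G(m,p,4)\<close> is either diagonal or a transposition whose two entries multiply to
  \<open>1\<close>. Since the group acts transitively on the coordinates, the transpositions occurring in a nice
  tuple form a connected graph on four vertices. Inspecting the cycle type of their product, three
  of them yield a \<open>4\<close>-cycle, which has simple eigenvalues, and four of them never yield the
  identity; with the multiplicity \<open>T - 2\<close> this forces all \<open>T\<close> reflections to be transpositions.
  Hence all entry products are \<open>1\<close>, i.e. \<open>W = G(m,m,4)\<close>, and the cycles of the product have entry
  products that are fourth roots of unity.

  Now raise all entries to the fourth power. In this representation the product of the \<open>T\<close>
  reflections fixes a plane. But (Scott's lemma for reflections) a product of at most \<open>n + 1\<close>
  reflections in dimension \<open>n\<close> without common fixed vectors or covectors fixes at most a line. So
  the fourth powers do have a common fixed vector or covector, which is impossible unless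
  \<open>m dvd 4\<close>. Conversely, for \<open>m = 2\<close> and \<open>m = 4\<close> explicit tuples, uniform in a primitive
  \<open>m\<close>-th root of unity, are nice.
\<close>

section \<open>Monomial matrices\<close>

text \<open>Why the fourth power: let x be the eigenvalue of multiplicity T - 2 of the inverse
  product N. A cycle of length r with entry product a contributes the factor X^r - a to the
  characteristic polynomial, and its roots are simple, so each cycle accounts for x at most once.
  The cycle types that survive have exactly T - 2 cycles, fixed points included. Hence x comes from
  every cycle, each entry product is a = x^r, and the total entry product of N is x^4. All factors
  being transpositions, this total is 1; so x^4 = 1 and a^4 = 1, and after raising entries to the
  fourth power each cycle carries a fixed vector of its own, at least two in all.

  Entrywise powers respect products only because monomial matrices multiply without adding entries;
  this is why matrices are handled through \<open>supp\<close> and \<open>coef\<close>. Covectors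
  are vectors for the inverse exponent. The bound of n + 1 = 5 reflections is what admits T = 4 and
  T = 5 alike. The explicit tuples reverse the argument: x = 1/z with z^4 = 1 is prescribed on every
  cycle.\<close>

definition monomial_mat :: "nat \<Rightarrow> complex mat \<Rightarrow> bool" where
  "monomial_mat n A \<longleftrightarrow> A \<in> carrier_mat n n \<and>
     (\<forall>i<n. \<exists>!j. j < n \<and> A $$ (i, j) \<noteq> 0) \<and>
     (\<forall>j<n. \<exists>!i. i < n \<and> A $$ (i, j) \<noteq> 0)"

text \<open>
  The nonzero entry of row \<open>i\<close> is \<open>coef A i\<close>, in column \<open>supp A i\<close>. The values \<open>1\<close> and \<open>i\<close> beyond
  the dimension make the product formulas hold without side conditions on \<open>i\<close>.
\<close>
definition supp :: "complex mat \<Rightarrow> nat \<Rightarrow> nat" where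
  "supp A i = (if i < dim_row A then THE j. j < dim_row A \<and> A $$ (i, j) \<noteq> 0 else i)"

definition coef :: "complex mat \<Rightarrow> nat \<Rightarrow> complex" where
  "coef A i = (if i < dim_row A then A $$ (i, supp A i) else 1)"

definition gpm :: "nat \<Rightarrow> (nat \<Rightarrow> complex) \<Rightarrow> (nat \<Rightarrow> nat) \<Rightarrow> complex mat" where
  "gpm n c \<sigma> = mat n n (\<lambda>(i, j). if j = \<sigma> i then c i else 0)"

lemma gpm_carrier [simp]: "gpm n c \<sigma> \<in> carrier_mat n n"
  and dim_gpm [simp]: "dim_row (gpm n c \<sigma>) = n" "dim_col (gpm n c \<sigma>) = n"
  by (auto simp: gpm_def)

lemma index_gpm: "i < n \<Longrightarrow> j < n \<Longrightarrow> gpm n c \<sigma> $$ (i, j) = (if j = \<sigma> i then c i else 0)"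
  by (simp add: gpm_def)

lemma index_gpm_nz:
  "i < n \<Longrightarrow> j < n \<Longrightarrow> c i \<noteq> 0 \<Longrightarrow> gpm n c \<sigma> $$ (i, j) \<noteq> 0 \<longleftrightarrow> j = \<sigma> i"
  by (simp add: index_gpm)

lemma monomial_gpm:
  assumes "\<sigma> permutes {..<n}" and "\<And>i. i < n \<Longrightarrow> c i \<noteq> 0"
  shows "monomial_mat n (gpm n c \<sigma>)"
  unfolding monomial_mat_def
proof (intro conjI allI impI)
  fix i assume i: "i < n"
  then have "\<sigma> i < n" using permutes_in_image[OF assms(1), of i] by simp
  then show "\<exists>!j. j < n \<and> gpm n c \<sigma> $$ (i, j) \<noteq> 0"
    using i assms(2)[of i] by (intro ex1I[of _ "\<sigma> i"]) (auto simp: index_gpm_nz)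
next
  fix j assume j: "j < n"
  let ?i = "inv_into UNIV \<sigma> j"
  have i: "?i < n" "\<sigma> ?i = j"
    using permutes_in_image[OF permutes_inv[OF assms(1)], of j] j
      permutes_inverses(1)[OF assms(1), of j] by simp_all
  show "\<exists>!i. i < n \<and> gpm n c \<sigma> $$ (i, j) \<noteq> 0"
  proof (rule ex1I[of _ ?i])
    show "?i < n \<and> gpm n c \<sigma> $$ (?i, j) \<noteq> 0"
      using i j assms(2)[of ?i] by (simp add: index_gpm)
  next
    fix i' assume "i' < n \<and> gpm n c \<sigma> $$ (i', j) \<noteq> 0"
    then have "\<sigma> i' = j" using j assms(2)[of i'] by (auto simp: index_gpm_nz)
    then show "i' = ?i" using permutes_inverses(2)[OF assms(1), of i'] by simp
  qed
qed auto

lemma supp_gpm: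
  assumes "\<sigma> permutes {..<n}" and "\<And>i. i < n \<Longrightarrow> c i \<noteq> 0"
  shows "supp (gpm n c \<sigma>) = \<sigma>"
proof
  fix i
  show "supp (gpm n c \<sigma>) i = \<sigma> i"
  proof (cases "i < n")
    case True
    then have "\<sigma> i < n" using permutes_in_image[OF assms(1), of i] by simp
    then have "(THE j. j < n \<and> gpm n c \<sigma> $$ (i, j) \<noteq> 0) = \<sigma> i"
      using True assms(2)[of i] by (intro the_equality) (auto simp: index_gpm_nz)
    then show ?thesis using True by (simp add: supp_def)
  next
    case False
    then show ?thesis using assms(1) by (simp add: supp_def permutes_not_in)
  qed
qed

lemma coef_gpm:
  assumes "\<sigma> permutes {..<n}" and "\<And>i. i < n \<Longrightarrow> c i \<noteq> 0"
  shows "coef (gpm n c \<sigma>) i = (if i < n then c i else 1)"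
  using permutes_in_image[OF assms(1), of i]
  by (simp add: coef_def supp_gpm[OF assms] index_gpm)

lemma monomial_carrier: "monomial_mat n A \<Longrightarrow> A \<in> carrier_mat n n"
  by (simp add: monomial_mat_def)

lemma supp_less:
  assumes "monomial_mat n A" "i < n"
  shows "supp A i < n" "A $$ (i, supp A i) \<noteq> 0"
proof -
  have "\<exists>!j. j < n \<and> A $$ (i, j) \<noteq> 0" using assms by (simp add: monomial_mat_def)
  from theI'[OF this] show "supp A i < n" "A $$ (i, supp A i) \<noteq> 0"
    using assms monomial_carrier[OF assms(1)] by (auto simp: supp_def)
qed

lemma supp_unique:
  assumes "monomial_mat n A" "i < n" "j < n" "A $$ (i, j) \<noteq> 0"
  shows "supp A i = j"
proof -
  have "\<exists>!j. j < n \<and> A $$ (i, j) \<noteq> 0" using assms(1,2) by (simp add: monomial_mat_def)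
  then show ?thesis using supp_less[OF assms(1,2)] assms(3,4) by (elim ex1E) metis
qed

lemma coef_nz: "monomial_mat n A \<Longrightarrow> coef A i \<noteq> 0"
  using supp_less[of n A i] monomial_carrier[of n A] by (auto simp: coef_def)

lemma coef_ge: "monomial_mat n A \<Longrightarrow> \<not> i < n \<Longrightarrow> coef A i = 1"
  using monomial_carrier[of n A] by (auto simp: coef_def)

lemma supp_permutes:
  assumes "monomial_mat n A"
  shows "supp A permutes {..<n}"
proof (rule bij_imp_permutes)
  have "inj_on (supp A) {..<n}"
  proof (rule inj_onI)
    fix i i' assume *: "i \<in> {..<n}" "i' \<in> {..<n}" "supp A i = supp A i'"
    then have "A $$ (i, supp A i) \<noteq> 0" "A $$ (i', supp A i) \<noteq> 0" "supp A i < n"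
      using supp_less[OF assms, of i] supp_less[OF assms, of i'] by auto
    moreover have "\<exists>!i. i < n \<and> A $$ (i, supp A i') \<noteq> 0"
      using assms supp_less[OF assms, of i'] * unfolding monomial_mat_def by simp
    ultimately show "i = i'" using * by (metis lessThan_iff)
  qed
  moreover have "supp A ` {..<n} \<subseteq> {..<n}" using supp_less[OF assms] by auto
  ultimately show "bij_betw (supp A) {..<n} {..<n}"
    by (simp add: bij_betw_def endo_inj_surj)
next
  fix i assume "i \<notin> {..<n}"
  then show "supp A i = i" using monomial_carrier[OF assms] by (auto simp: supp_def)
qed

lemma monomial_eq_gpm:
  assumes "monomial_mat n A"
  shows "A = gpm n (coef A) (supp A)"
proof (rule eq_matI)
  fix i j assume "i < dim_row (gpm n (coef A) (supp A))" "j < dim_col (gpm n (coef A) (supp A))"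
  then show "A $$ (i, j) = gpm n (coef A) (supp A) $$ (i, j)"
    using supp_unique[OF assms, of i j] monomial_carrier[OF assms] by (auto simp: index_gpm coef_def)
qed (use monomial_carrier[OF assms] in auto)

lemma monomial_cong:
  assumes "monomial_mat n A" "monomial_mat n B" "\<And>i. i < n \<Longrightarrow> coef A i = coef B i"
    and "\<And>i. i < n \<Longrightarrow> supp A i = supp B i"
  shows "A = B"
  by (subst monomial_eq_gpm[OF assms(1)], subst monomial_eq_gpm[OF assms(2)])
    (auto simp: gpm_def assms(3,4) intro!: eq_matI)

text \<open>Row \<open>i\<close> of the left factor selects row \<open>\<sigma> i\<close> of the
  right one, so each sum in the matrix product has at most one nonzero term. As
  \<open>\<sigma>\<close> maps rows to columns, permutations compose in reverse order.\<close>

lemma gpm_mult: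
  assumes "\<sigma> permutes {..<n}"
  shows "gpm n c \<sigma> * gpm n d \<tau> = gpm n (\<lambda>i. c i * d (\<sigma> i)) (\<tau> \<circ> \<sigma>)"
proof (rule eq_matI)
  fix i j assume "i < dim_row (gpm n (\<lambda>i. c i * d (\<sigma> i)) (\<tau> \<circ> \<sigma>))"
    "j < dim_col (gpm n (\<lambda>i. c i * d (\<sigma> i)) (\<tau> \<circ> \<sigma>))"
  then have ij: "i < n" "j < n" by auto
  then have s: "\<sigma> i < n" using permutes_in_image[OF assms, of i] by simp
  have "(gpm n c \<sigma> * gpm n d \<tau>) $$ (i, j) =
      (\<Sum>k = 0..<n. gpm n c \<sigma> $$ (i, k) * gpm n d \<tau> $$ (k, j))"
    using ij by (simp add: scalar_prod_def)
  also have "\<dots> = (\<Sum>k = 0..<n. if k = \<sigma> i then c i * gpm n d \<tau> $$ (k, j) else 0)"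
    using ij by (intro sum.cong) (auto simp: index_gpm)
  also have "\<dots> = c i * gpm n d \<tau> $$ (\<sigma> i, j)" using s by simp
  finally show "(gpm n c \<sigma> * gpm n d \<tau>) $$ (i, j) = gpm n (\<lambda>i. c i * d (\<sigma> i)) (\<tau> \<circ> \<sigma>) $$ (i, j)"
    using ij s by (simp add: index_gpm)
qed auto

lemma one_mat_eq_gpm: "1\<^sub>m n = gpm n (\<lambda>_. 1) id"
  by (auto simp: gpm_def intro!: eq_matI)

lemma monomial_one: "monomial_mat n (1\<^sub>m n)"
  and supp_one: "supp (1\<^sub>m n) = id"
  and coef_one: "coef (1\<^sub>m n) i = 1"
  unfolding one_mat_eq_gpm by (auto simp: monomial_gpm supp_gpm coef_gpm permutes_id)

lemma monomial_mult:
  assumes A: "monomial_mat n A" and B: "monomial_mat n B"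
  shows "monomial_mat n (A * B)"
    and supp_mult: "supp (A * B) = supp B \<circ> supp A"
    and coef_mult: "coef (A * B) i = coef A i * coef B (supp A i)"
proof -
  have p: "supp B \<circ> supp A permutes {..<n}"
    using supp_permutes[OF A] supp_permutes[OF B] by (rule permutes_compose)
  have AB: "A * B = gpm n (\<lambda>i. coef A i * coef B (supp A i)) (supp B \<circ> supp A)"
    using gpm_mult[OF supp_permutes[OF A], of "coef A" "coef B" "supp B"]
    by (simp flip: monomial_eq_gpm[OF A] monomial_eq_gpm[OF B])
  show "monomial_mat n (A * B)" "supp (A * B) = supp B \<circ> supp A"
    unfolding AB using p coef_nz[OF A] coef_nz[OF B] by (auto simp: monomial_gpm supp_gpm)
  show "coef (A * B) i = coef A i * coef B (supp A i)"
    unfolding AB using p coef_nz[OF A] coef_nz[OF B] coef_ge[OF A] coef_ge[OF B]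
      permutes_not_in[OF supp_permutes[OF A], of i]
    by (auto simp: coef_gpm)
qed

text \<open>The nonzero positions are exactly the pairs \<open>(i, supp A i)\<close>, so the product
  over positions becomes a product over rows.\<close>

lemma Gmpn_iff:
  "A \<in> Gmpn m p n \<longleftrightarrow> monomial_mat n A \<and> (\<forall>i<n. coef A i ^ m = 1) \<and>
     (\<Prod>i<n. coef A i) ^ (m div p) = 1"
proof (cases "monomial_mat n A")
  case True
  have A: "A \<in> carrier_mat n n" using True by (rule monomial_carrier)
  have eq: "{x. x \<in> {..<n} \<times> {..<n} \<and> A $$ x \<noteq> 0} = (\<lambda>i. (i, supp A i)) ` {..<n}"
  proof (intro equalityI subsetI)
    fix x assume "x \<in> {x. x \<in> {..<n} \<times> {..<n} \<and> A $$ x \<noteq> 0}"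
    then show "x \<in> (\<lambda>i. (i, supp A i)) ` {..<n}"
      using supp_unique[OF True, of "fst x" "snd x"] by (cases x) auto
  qed (use supp_less[OF True] in auto)
  have prd: "(\<Prod>x | x \<in> {..<n} \<times> {..<n} \<and> A $$ x \<noteq> 0. A $$ x) = (\<Prod>i<n. coef A i)"
    unfolding eq using A by (subst prod.reindex) (auto simp: inj_on_def coef_def)
  have ent: "(\<forall>i<n. \<forall>j<n. A $$ (i, j) \<noteq> 0 \<longrightarrow> A $$ (i, j) ^ m = 1) \<longleftrightarrow> (\<forall>i<n. coef A i ^ m = 1)"
  proof (intro iffI allI impI)
    fix i j assume "\<forall>i<n. coef A i ^ m = 1" "i < n" "j < n" "A $$ (i, j) \<noteq> 0"
    then show "A $$ (i, j) ^ m = 1"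
      using supp_unique[OF True, of i j] A by (auto simp: coef_def)
  next
    fix i assume "\<forall>i<n. \<forall>j<n. A $$ (i, j) \<noteq> 0 \<longrightarrow> A $$ (i, j) ^ m = 1" "i < n"
    then show "coef A i ^ m = 1"
      using supp_less[OF True, of i] A by (simp add: coef_def)
  qed
  have "A \<in> Gmpn m p n \<longleftrightarrow> A \<in> carrier_mat n n \<and>
     (\<forall>i<n. \<exists>!j. j < n \<and> A $$ (i, j) \<noteq> 0) \<and>
     (\<forall>j<n. \<exists>!i. i < n \<and> A $$ (i, j) \<noteq> 0) \<and>
     (\<forall>i<n. coef A i ^ m = 1) \<and> (\<Prod>i<n. coef A i) ^ (m div p) = 1"
    unfolding Gmpn_def mem_Collect_eq prd ent ..
  also have "\<dots> \<longleftrightarrow> monomial_mat n A \<and> (\<forall>i<n. coef A i ^ m = 1) \<and>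
     (\<Prod>i<n. coef A i) ^ (m div p) = 1"
    unfolding monomial_mat_def conj_assoc ..
  finally show ?thesis .
next
  case False
  then have "A \<notin> Gmpn m p n" unfolding Gmpn_def monomial_mat_def by blast
  with False show ?thesis by simp
qed

text \<open>\<open>supp A\<close> only permutes the factors coming from \<open>B\<close>. The entry
  product is the determinant up to the sign of the permutation.\<close>

lemma prod_coef_mult:
  assumes "monomial_mat n A" "monomial_mat n B"
  shows "(\<Prod>i<n. coef (A * B) i) = (\<Prod>i<n. coef A i) * (\<Prod>i<n. coef B i)"
proof -
  have "(\<Prod>i<n. coef B (supp A i)) = (\<Prod>i<n. coef B i)"
    using prod.permute[OF supp_permutes[OF assms(1)], of "coef B"] by (simp add: comp_def)
  then show ?thesis by (simp add: coef_mult[OF assms] prod.distrib)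
qed

lemma Gmpn_mult:
  assumes "A \<in> Gmpn m p n" "B \<in> Gmpn m p n"
  shows "A * B \<in> Gmpn m p n"
proof -
  have AB: "monomial_mat n A" "monomial_mat n B" using assms by (auto simp: Gmpn_iff)
  have "coef (A * B) i ^ m = 1" if "i < n" for i
    using assms that supp_less(1)[OF AB(1) that] unfolding coef_mult[OF AB]
    by (simp add: Gmpn_iff power_mult_distrib)
  moreover have "(\<Prod>i<n. coef (A * B) i) ^ (m div p) = 1"
    using assms unfolding prod_coef_mult[OF AB] power_mult_distrib by (simp only: Gmpn_iff mult_1_left)
  ultimately show ?thesis using monomial_mult(1)[OF AB] by (simp only: Gmpn_iff) simp
qed

lemma one_Gmpn: "1\<^sub>m n \<in> Gmpn m p n"
  by (simp add: Gmpn_iff monomial_one coef_one)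

text \<open>The action of the entrywise \<open>k\<close>-th power of \<open>A\<close> on column vectors.\<close>
definition act :: "nat \<Rightarrow> complex mat \<Rightarrow> (nat \<Rightarrow> complex) \<Rightarrow> nat \<Rightarrow> complex" where
  "act k A v i = coef A i ^ k * v (supp A i)"

lemma act_mult:
  assumes "monomial_mat n A" "monomial_mat n B"
  shows "act k (A * B) v = act k A (act k B v)"
  by (auto simp: act_def coef_mult[OF assms] supp_mult[OF assms] power_mult_distrib)

lemma act_one: "act k (1\<^sub>m n) v = v"
  by (auto simp: act_def coef_one supp_one)

section \<open>Characteristic polynomials of monomial matrices\<close>

text \<open>Laplace expansion along the top row, with each minor written again as
  \<open>mat n n\<close> of a function and the deleted column expressed by an index shift. In this
  form it rewrites repeatedly, down to explicit entries.\<close>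

lemma det_Suc:
  "det (mat (Suc n) (Suc n) f :: 'a :: comm_ring_1 mat) =
     (\<Sum>j<Suc n. (-1) ^ j * f (0, j) * det (mat n n (\<lambda>(a, b). f (Suc a, if b < j then b else Suc b))))"
proof -
  have "cofactor (mat (Suc n) (Suc n) f) 0 j =
      (-1) ^ j * det (mat n n (\<lambda>(a, b). f (Suc a, if b < j then b else Suc b)))" for j
    unfolding cofactor_def mat_delete_def
    by (simp, intro arg_cong[of _ _ "\<lambda>x. _ * det x"] eq_matI) auto
  then show ?thesis
    by (subst laplace_expansion_row[of _ "Suc n" 0]) (auto intro!: sum.cong simp: algebra_simps)
qed

lemma det_mat_4:
  fixes f :: "nat \<times> nat \<Rightarrow> 'a :: comm_ring_1"
  shows "det (mat 4 4 f) =
    f (0,0) * (f (1,1) * (f (2,2) * f (3,3) - f (2,3) * f (3,2))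
             - f (1,2) * (f (2,1) * f (3,3) - f (2,3) * f (3,1))
             + f (1,3) * (f (2,1) * f (3,2) - f (2,2) * f (3,1)))
  - f (0,1) * (f (1,0) * (f (2,2) * f (3,3) - f (2,3) * f (3,2))
             - f (1,2) * (f (2,0) * f (3,3) - f (2,3) * f (3,0))
             + f (1,3) * (f (2,0) * f (3,2) - f (2,2) * f (3,0)))
  + f (0,2) * (f (1,0) * (f (2,1) * f (3,3) - f (2,3) * f (3,1))
             - f (1,1) * (f (2,0) * f (3,3) - f (2,3) * f (3,0))
             + f (1,3) * (f (2,0) * f (3,1) - f (2,1) * f (3,0)))
  - f (0,3) * (f (1,0) * (f (2,1) * f (3,2) - f (2,2) * f (3,1))
             - f (1,1) * (f (2,0) * f (3,2) - f (2,2) * f (3,0))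
             + f (1,2) * (f (2,0) * f (3,1) - f (2,1) * f (3,0)))"
  by (simp add: eval_nat_numeral det_Suc lessThan_Suc algebra_simps)

text \<open>Rows and columns are permuted by the same \<open>\<pi>\<close>, and the two signs
  cancel. This allows the indices to be named along the cycles of a permutation.\<close>

lemma det_relabel:
  assumes "\<pi> permutes {..<n}"
  shows "det (mat n n (\<lambda>(a, b). f (\<pi> a, \<pi> b)) :: 'a :: comm_ring_1 mat) = det (mat n n f)"
proof -
  have p: "\<pi> permutes {0..<n}" using assms by (simp add: atLeast0LessThan)
  have lt: "\<pi> a < n" if "a < n" for a using permutes_in_image[OF assms, of a] that by simp
  let ?B = "mat n n (\<lambda>(a, b). f (a, \<pi> b))"
  have "det (mat n n (\<lambda>(a, b). f (\<pi> a, \<pi> b))) = signof \<pi> * det ?B"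
    by (subst det_permute_rows[OF _ p, of ?B, symmetric])
      (auto intro!: arg_cong[of _ _ det] eq_matI simp: lt)
  also have "det ?B = det (mat n n (\<lambda>(a, b). f (b, \<pi> a)))"
    by (subst det_transpose[of ?B n, symmetric]) (auto intro!: arg_cong[of _ _ det] eq_matI)
  also have "\<dots> = signof \<pi> * det (mat n n (\<lambda>(a, b). f (b, a)))"
    by (subst det_permute_rows[OF _ p, of "mat n n (\<lambda>(a, b). f (b, a))", symmetric])
      (auto intro!: arg_cong[of _ _ det] eq_matI simp: lt)
  also have "det (mat n n (\<lambda>(a, b). f (b, a))) = det (mat n n f)"
    by (subst det_transpose[of _ n, symmetric]) (auto intro!: arg_cong[of _ _ det] eq_matI)
  finally show ?thesis by (simp add: sign_def)
qed

lemma four_distinct: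
  assumes "{i, j, k, l} = {..<4::nat}"
  shows "distinct [i, j, k, l]"
proof -
  have "card (set [i, j, k, l]) = length [i, j, k, l]" using assms by simp
  then show ?thesis by (rule card_distinct)
qed

lemma four_lt:
  assumes "{i, j, k, l} = {..<4::nat}"
  shows "i < 4" "j < 4" "k < 4" "l < 4"
  using assms by auto

text \<open>With free names for the four indices, one computation covers all permutations of a given
  cycle type.\<close>

lemma char_poly_4:
  fixes A :: "'a :: comm_ring_1 mat"
  assumes A: "A \<in> carrier_mat 4 4" and s: "{i, j, k, l} = {..<4::nat}"
  defines "g \<equiv> \<lambda>a b. (if a = b then [:- (A $$ (a, b)), 1:] else [:- (A $$ (a, b)):])"
  shows "char_poly A =
    g i i * (g j j * (g k k * g l l - g k l * g l k)
             - g j k * (g k j * g l l - g k l * g l j)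
             + g j l * (g k j * g l k - g k k * g l j))
  - g i j * (g j i * (g k k * g l l - g k l * g l k)
             - g j k * (g k i * g l l - g k l * g l i)
             + g j l * (g k i * g l k - g k k * g l i))
  + g i k * (g j i * (g k j * g l l - g k l * g l j)
             - g j j * (g k i * g l l - g k l * g l i)
             + g j l * (g k i * g l j - g k j * g l i))
  - g i l * (g j i * (g k j * g l k - g k k * g l j)
             - g j j * (g k i * g l k - g k k * g l i)
             + g j k * (g k i * g l j - g k j * g l i))"
proof -
  \<comment> \<open>The value \<open>a\<close> beyond 3 is what \<open>permutes\<close> demands
    outside the four indices.\<close>
  define p where "p a = (if a = 0 then i else if a = 1 then j else if a = 2 then k else
    if a = 3 then l else a)" for a :: nat
  note d = four_distinct[OF s]
  have "bij_betw p {..<4} {..<4}"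
    unfolding bij_betw_def
  proof
    have 4: "{..<4::nat} = {0, 1, 2, 3}" by auto
    show "inj_on p {..<4}" unfolding 4 using d by (auto simp: p_def)
    have "p ` {..<4} = {p 0, p 1, p 2, p 3}" unfolding 4 by simp
    also have "\<dots> = {i, j, k, l}" by (simp add: p_def)
    also note s
    finally show "p ` {..<4} = {..<4}" .
  qed
  then have p: "p permutes {..<4}" by (rule bij_imp_permutes) (auto simp: p_def)
  have "char_poly_matrix A = mat 4 4 (\<lambda>(a, b). g a b)"
    using A unfolding char_poly_matrix_def g_def by (intro eq_matI) auto
  then have "char_poly A = det (mat 4 4 (\<lambda>(a, b). g (p a) (p b)))"
    using det_relabel[OF p, of "\<lambda>(a, b). g a b"] by (simp add: char_poly_def)
  then show ?thesis unfolding det_mat_4 by (simp add: p_def)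
qed

lemma monomial_index:
  assumes "monomial_mat n A" "i < n" "j < n"
  shows "A $$ (i, j) = (if j = supp A i then coef A i else 0)"
  by (subst monomial_eq_gpm[OF assms(1)]) (simp add: index_gpm assms)

context
  fixes A :: "complex mat" and i j k l :: nat
  assumes A: "monomial_mat 4 A" and s: "{i, j, k, l} = {..<4::nat}"
begin

lemmas char_poly_monomial_simps =
  char_poly_4[OF monomial_carrier[OF A] s] monomial_index[OF A] four_lt[OF s]

text \<open>Here and for the three cycle types that follow, a cycle of length r with entry product a
  contributes the factor X^r - a.\<close>

lemma char_poly_transposition:
  assumes "supp A i = j" "supp A j = i" "supp A k = k" "supp A l = l"
  shows "char_poly A =
    (monom 1 2 - [:coef A i * coef A j:]) * [:- coef A k, 1:] * [:- coef A l, 1:]"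
  using four_distinct[OF s] unfolding char_poly_monomial_simps
  by (simp add: monomial_index[OF A] four_lt[OF s] assms monom_altdef power2_eq_square algebra_simps)

lemma char_poly_double_transposition:
  assumes "supp A i = j" "supp A j = i" "supp A k = l" "supp A l = k"
  shows "char_poly A =
    (monom 1 2 - [:coef A i * coef A j:]) * (monom 1 2 - [:coef A k * coef A l:])"
  using four_distinct[OF s] unfolding char_poly_monomial_simps
  by (simp add: monomial_index[OF A] four_lt[OF s] assms monom_altdef power2_eq_square)

lemma char_poly_3_cycle:
  assumes "supp A i = j" "supp A j = k" "supp A k = i" "supp A l = l"
  shows "char_poly A = (monom 1 3 - [:coef A i * coef A j * coef A k:]) * [:- coef A l, 1:]"
  using four_distinct[OF s] unfolding char_poly_monomial_simps
  by (simp add: monomial_index[OF A] four_lt[OF s] assms monom_altdef power3_eq_cube)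

lemma char_poly_4_cycle:
  assumes "supp A i = j" "supp A j = k" "supp A k = l" "supp A l = i"
  shows "char_poly A = monom 1 4 - [:coef A i * coef A j * coef A k * coef A l:]"
  using four_distinct[OF s] unfolding char_poly_monomial_simps
  by (simp add: monomial_index[OF A] four_lt[OF s] assms monom_altdef power4_eq_xxxx)

end

lemma order_linear: "Polynomial.order x [:- c, 1 :: complex:] = (if x = c then 1 else 0)"
  using order_power_n_n[of x 1] by (auto intro: order_0I)

text \<open>The derivative n X^(n-1) does not vanish at a root, since \<open>a\<close> is nonzero.
  So all roots are simple.\<close>

lemma order_cyclic:
  fixes a x :: complex
  assumes "a \<noteq> 0" "n > 0"
  shows "Polynomial.order x (monom 1 n - [:a:]) = (if x ^ n = a then 1 else 0)"
proof -
  let ?p = "monom 1 n - [:a:]"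
  have nz: "?p \<noteq> 0"
  proof
    assume "?p = 0"
    then have "coeff ?p 0 = 0" by simp
    then show False using assms by simp
  qed
  show ?thesis
  proof (cases "x ^ n = a")
    case True
    then have "x \<noteq> 0" using assms by auto
    have "poly ?p x = 0" using True by (simp add: poly_monom)
    moreover have pd: "poly (pderiv ?p) x \<noteq> 0"
      using \<open>x \<noteq> 0\<close> assms by (simp add: pderiv_diff pderiv_monom poly_monom pderiv_pCons)
    ultimately have "Polynomial.order x ?p = Suc (Polynomial.order x (pderiv ?p))"
      using nz by (intro order_pderiv) (auto simp: order_root)
    then show ?thesis using pd True by (simp add: order_0I)
  next
    case False
    then show ?thesis by (simp add: order_0I poly_monom)
  qed
qed

lemma cyclic_nz: "n > 0 \<Longrightarrow> monom 1 n - [:a :: complex:] \<noteq> 0"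
  by (metis degree_monom_eq degree_pCons_0 diff_eq_diff_eq diff_zero eq_iff_diff_eq_0 less_irrefl one_neq_zero)

section \<open>Reflections\<close>

text \<open>Decided by evaluation, hence the quantifiers over \<open>set [0, 1, 2, 3]\<close>. The
  five lists are the images of \<open>i\<close>, \<open>j\<close>, \<open>k\<close>,
  \<open>l\<close> under the identity, a transposition, a double transposition, a 3-cycle and a
  4-cycle.\<close>

lemma four_cycle_types_aux:
  "\<forall>a\<in>set [0, 1, 2, 3]. \<forall>b\<in>set [0, 1, 2, 3]. \<forall>c\<in>set [0, 1, 2, 3]. \<forall>d\<in>set [0, 1, 2, 3].
   distinct [a, b, c, d :: nat] \<longrightarrow>
   (\<exists>i\<in>set [0, 1, 2, 3]. \<exists>j\<in>set [0, 1, 2, 3]. \<exists>k\<in>set [0, 1, 2, 3]. \<exists>l\<in>set [0, 1, 2, 3].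
      distinct [i, j, k, l :: nat] \<and>
      map (nth [a, b, c, d]) [i, j, k, l] \<in>
        set [[i, j, k, l], [j, i, k, l], [j, i, l, k], [j, k, i, l], [j, k, l, i]])"
  by code_simp

lemma four_eqI:
  assumes "distinct [i, j, k, l]" "set [i, j, k, l] \<subseteq> {..<4::nat}"
  shows "{i, j, k, l} = {..<4}"
proof -
  have "card (set [i, j, k, l]) = 4" using distinct_card[OF assms(1)] by simp
  then have "set [i, j, k, l] = {..<4}" using assms(2) by (intro card_subset_eq) auto
  then show ?thesis by simp
qed

lemma perm4_cases [consumes 1, case_names id trans dtrans cyc3 cyc4]:
  assumes p: "\<sigma> permutes {..<4::nat}"
  obtains "\<sigma> = id"
  | i j k l where "{i, j, k, l} = {..<4}" "\<sigma> i = j" "\<sigma> j = i" "\<sigma> k = k" "\<sigma> l = l"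
  | i j k l where "{i, j, k, l} = {..<4}" "\<sigma> i = j" "\<sigma> j = i" "\<sigma> k = l" "\<sigma> l = k"
  | i j k l where "{i, j, k, l} = {..<4}" "\<sigma> i = j" "\<sigma> j = k" "\<sigma> k = i" "\<sigma> l = l"
  | i j k l where "{i, j, k, l} = {..<4}" "\<sigma> i = j" "\<sigma> j = k" "\<sigma> k = l" "\<sigma> l = i"
proof -
  have 4: "x \<in> set [0, 1, 2, 3] \<longleftrightarrow> x < 4" for x :: nat by auto
  have r: "\<sigma> x \<in> set [0, 1, 2, 3]" if "x < 4" for x
    using permutes_in_image[OF p, of x] that unfolding 4 by simp
  have "distinct [\<sigma> 0, \<sigma> 1, \<sigma> 2, \<sigma> 3]"
    using permutes_inj[OF p] by (simp add: inj_eq)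
  then have "\<exists>i\<in>set [0, 1, 2, 3]. \<exists>j\<in>set [0, 1, 2, 3]. \<exists>k\<in>set [0, 1, 2, 3]. \<exists>l\<in>set [0, 1, 2, 3].
      distinct [i, j, k, l] \<and>
      map (nth [\<sigma> 0, \<sigma> 1, \<sigma> 2, \<sigma> 3]) [i, j, k, l] \<in>
        set [[i, j, k, l], [j, i, k, l], [j, i, l, k], [j, k, i, l], [j, k, l, i]]"
    by (intro four_cycle_types_aux[rule_format] r) simp_all
  then obtain i j k l where ijkl: "i \<in> set [0, 1, 2, 3]" "j \<in> set [0, 1, 2, 3]"
      "k \<in> set [0, 1, 2, 3]" "l \<in> set [0, 1, 2, 3]" "distinct [i, j, k, l]"
    and m: "map (nth [\<sigma> 0, \<sigma> 1, \<sigma> 2, \<sigma> 3]) [i, j, k, l] \<in>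
        set [[i, j, k, l], [j, i, k, l], [j, i, l, k], [j, k, i, l], [j, k, l, i]]"
    by (elim bexE conjE) (rule that)
  have s: "{i, j, k, l} = {..<4}"
    using ijkl unfolding 4 by (intro four_eqI) auto
  have n: "[\<sigma> 0, \<sigma> 1, \<sigma> 2, \<sigma> 3] ! x = \<sigma> x" if "x \<in> set [0, 1, 2, 3]" for x
    using that by auto
  have "[\<sigma> i, \<sigma> j, \<sigma> k, \<sigma> l] \<in>
      set [[i, j, k, l], [j, i, k, l], [j, i, l, k], [j, k, i, l], [j, k, l, i]]"
    using m n ijkl(1-4) by (simp only: list.map)
  then consider "\<sigma> i = i" "\<sigma> j = j" "\<sigma> k = k" "\<sigma> l = l" | "\<sigma> i = j" "\<sigma> j = i" "\<sigma> k = k" "\<sigma> l = l"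
    | "\<sigma> i = j" "\<sigma> j = i" "\<sigma> k = l" "\<sigma> l = k" | "\<sigma> i = j" "\<sigma> j = k" "\<sigma> k = i" "\<sigma> l = l"
    | "\<sigma> i = j" "\<sigma> j = k" "\<sigma> k = l" "\<sigma> l = i"
    unfolding list.set insert_iff list.inject empty_iff by (elim disjE conjE FalseE; blast)
  then show ?thesis
  proof cases
    case 1
    have "\<sigma> x = x" for x
    proof (cases "x \<in> {i, j, k, l}")
      case False
      then show ?thesis unfolding s by (rule permutes_not_in[OF p])
    qed (use 1 in auto)
    then show ?thesis by (intro that(1)) auto
  next
    case 2 then show ?thesis by (rule that(2)[OF s])
  next
    case 3 then show ?thesis by (rule that(3)[OF s])
  next
    case 4 then show ?thesis by (rule that(4)[OF s])
  next
    case 5 then show ?thesis by (rule that(5)[OF s])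
  qed
qed

text \<open>For nonzero \<open>a\<close> there are \<open>n\<close> distinct roots, while a
  reflection leaves room for two eigenvalues. So its cycles have length at most two, and a 2-cycle
  uses up both values, 1 and -1.\<close>

lemma cyclic_eq_pair:
  fixes a l :: complex
  assumes "a \<noteq> 0" "n > 0" "{u. u ^ n = a} \<subseteq> {1, l}"
  shows "n \<le> 2" "n = 2 \<Longrightarrow> a = 1 \<and> l = -1"
proof -
  have c: "card {u. u ^ n = a} = n" using assms by (intro card_nth_roots) auto
  have "card {u. u ^ n = a} \<le> card {1, l}" using assms(3) by (intro card_mono) auto
  also have "\<dots> \<le> 2" by (simp add: card_insert_if)
  finally show "n \<le> 2" using c by simp
  assume n: "n = 2"
  have "card {1, l} \<le> 2" by (simp add: card_insert_if)
  then have "{u. u ^ n = a} = {1, l}" using assms(3) c n by (intro card_seteq) auto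
  then have "1 \<in> {u. u ^ n = a}" "l \<in> {u. u ^ n = a}" "card {1, l} = 2" using c n by auto
  then have "a = 1" "l ^ 2 = 1" "l \<noteq> 1" using n by auto
  then show "a = 1 \<and> l = -1" by (simp add: power2_eq_1_iff)
qed

context
  fixes A :: "complex mat" and i j k l :: nat
  assumes A: "monomial_mat 4 A" and s: "{i, j, k, l} = {..<4::nat}"
begin

lemma eigenvalue_mult_transposition:
  assumes "supp A i = j" "supp A j = i" "supp A k = k" "supp A l = l"
  shows "eigenvalue_mult A x =
    of_bool (x ^ 2 = coef A i * coef A j) + of_bool (x = coef A k) + of_bool (x = coef A l)"
proof -
  have nz: "monom 1 2 - [:coef A i * coef A j:] \<noteq> 0" "[:- coef A k, 1:] \<noteq> 0" "[:- coef A l, 1:] \<noteq> 0"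
    using cyclic_nz[of 2] by auto
  show ?thesis unfolding eigenvalue_mult_def char_poly_transposition[OF A s assms]
    using nz coef_nz[OF A]
    by (simp only: order_mult mult_eq_0_iff order_linear order_cyclic simp_thms of_bool_def zero_less_numeral)
qed

lemma eigenvalue_mult_double_transposition:
  assumes "supp A i = j" "supp A j = i" "supp A k = l" "supp A l = k"
  shows "eigenvalue_mult A x =
    of_bool (x ^ 2 = coef A i * coef A j) + of_bool (x ^ 2 = coef A k * coef A l)"
proof -
  have nz: "monom 1 2 - [:coef A i * coef A j:] \<noteq> 0" "monom 1 2 - [:coef A k * coef A l:] \<noteq> 0"
    using cyclic_nz[of 2] by auto
  show ?thesis unfolding eigenvalue_mult_def char_poly_double_transposition[OF A s assms]
    using nz coef_nz[OF A]
    by (simp only: order_mult mult_eq_0_iff order_linear order_cyclic simp_thms of_bool_def zero_less_numeral)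
qed

lemma eigenvalue_mult_3_cycle:
  assumes "supp A i = j" "supp A j = k" "supp A k = i" "supp A l = l"
  shows "eigenvalue_mult A x =
    of_bool (x ^ 3 = coef A i * coef A j * coef A k) + of_bool (x = coef A l)"
proof -
  have nz: "monom 1 3 - [:coef A i * coef A j * coef A k:] \<noteq> 0" "[:- coef A l, 1:] \<noteq> 0"
    using cyclic_nz[of 3] by auto
  show ?thesis unfolding eigenvalue_mult_def char_poly_3_cycle[OF A s assms]
    using nz coef_nz[OF A]
    by (simp only: order_mult mult_eq_0_iff order_linear order_cyclic simp_thms of_bool_def zero_less_numeral)
qed

lemma eigenvalue_mult_4_cycle:
  assumes "supp A i = j" "supp A j = k" "supp A k = l" "supp A l = i"
  shows "eigenvalue_mult A x = of_bool (x ^ 4 = coef A i * coef A j * coef A k * coef A l)"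
  unfolding eigenvalue_mult_def char_poly_4_cycle[OF A s assms] using coef_nz[OF A]
  by (simp only: mult_eq_0_iff order_cyclic simp_thms of_bool_def zero_less_numeral)

end

text \<open>All eigenvalues lie in {1, x} with x simple. Cycles of length 3 and 4 have too many
  eigenvalues; two 2-cycles would make -1 a double one; beside a single 2-cycle the value -1 is
  already taken, so both remaining entries are 1.\<close>

lemma reflection_cases [consumes 2, case_names diag trans]:
  assumes A: "monomial_mat 4 A" and refl: "is_reflection 4 A"
  obtains "supp A = id"
  | i j k l where "{i, j, k, l} = {..<4}" "supp A i = j" "supp A j = i" "supp A k = k" "supp A l = l"
      "coef A i * coef A j = 1" "coef A k = 1" "coef A l = 1"
proof -
  obtain x where x: "{u. eigenvalue A u \<and> u \<noteq> 1} = {x}" "eigenvalue_mult A x = 1"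
    using refl by (auto simp: is_reflection_def)
  have root: "u \<in> {1, x}" if "poly (char_poly A) u = 0" for u
    using x(1) that eigenvalue_root_char_poly[OF monomial_carrier[OF A], of u] by auto
  have x1: "x \<noteq> 1" using x(1) by auto
  note nz = coef_nz[OF A]
  show ?thesis
    using supp_permutes[OF A]
  proof (cases rule: perm4_cases)
    case id
    then show ?thesis by (rule that(1))
  next
    case (trans i j k l)
    note cp = char_poly_transposition[OF A trans]
    have "{u. u ^ 2 = coef A i * coef A j} \<subseteq> {1, x}"
      using root unfolding cp by (auto simp: poly_monom)
    from cyclic_eq_pair(2)[OF _ _ this] have a: "coef A i * coef A j = 1" "x = -1"
      using nz by auto
    have "poly (char_poly A) (coef A k) = 0" "poly (char_poly A) (coef A l) = 0"
      unfolding cp by simp_all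
    note kl = this[THEN root]
    have "x ^ 2 = coef A i * coef A j" using a by simp
    then have "eigenvalue_mult A x = 1 + of_bool (x = coef A k) + of_bool (x = coef A l)"
      unfolding eigenvalue_mult_transposition[OF A trans] by simp
    then have "coef A k = 1" "coef A l = 1" using x(2) kl by (auto simp: of_bool_def split: if_splits)
    then show ?thesis using that(2)[OF trans a(1)] by blast
  next
    case (dtrans i j k l)
    note cp = char_poly_double_transposition[OF A dtrans]
    have "{u. u ^ 2 = coef A i * coef A j} \<subseteq> {1, x}" "{u. u ^ 2 = coef A k * coef A l} \<subseteq> {1, x}"
      using root unfolding cp by (auto simp: poly_monom)
    from cyclic_eq_pair(2)[OF _ _ this(1)] cyclic_eq_pair(2)[OF _ _ this(2)]
    have a: "coef A i * coef A j = 1" "coef A k * coef A l = 1" "x = -1"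
      using nz by auto
    have "eigenvalue_mult A x = 2"
      unfolding eigenvalue_mult_double_transposition[OF A dtrans] using a by simp
    then show ?thesis using x(2) by simp
  next
    case (cyc3 i j k l)
    note cp = char_poly_3_cycle[OF A cyc3]
    have "{u. u ^ 3 = coef A i * coef A j * coef A k} \<subseteq> {1, x}"
      using root unfolding cp by (auto simp: poly_monom)
    from cyclic_eq_pair(1)[OF _ _ this] show ?thesis using nz by simp
  next
    case (cyc4 i j k l)
    note cp = char_poly_4_cycle[OF A cyc4]
    have "{u. u ^ 4 = coef A i * coef A j * coef A k * coef A l} \<subseteq> {1, x}"
      using root unfolding cp by (auto simp: poly_monom)
    from cyclic_eq_pair(1)[OF _ _ this] show ?thesis using nz by simp
  qed
qed

section \<open>Products of connected transpositions\<close>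

text \<open>Lists make edges and splits enumerable, so that the statements below are decided by
  evaluation. Connectedness is expressed as every split being crossed by some edge.\<close>

abbreviation (input) edges4 :: "(nat \<times> nat) set" where
  "edges4 \<equiv> set [(0, 1), (0, 2), (0, 3), (1, 2), (1, 3), (2, 3)]"

text \<open>The partitions of the four vertices into two nonempty parts, each given by one part.\<close>
abbreviation (input) splits4 :: "nat list set" where
  "splits4 \<equiv> set [[0], [1], [2], [3], [0, 1], [0, 2], [0, 3]]"

abbreviation (input) tr :: "nat \<times> nat \<Rightarrow> nat \<Rightarrow> nat" where
  "tr e x \<equiv> transpose (fst e) (snd e) x"

abbreviation (input) unsplit :: "nat list \<Rightarrow> nat \<times> nat \<Rightarrow> bool" where
  "unsplit S e \<equiv> (fst e \<in> set S \<longleftrightarrow> snd e \<in> set S)"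

lemma two_edges: "\<forall>a\<in>edges4. \<forall>b\<in>edges4. \<exists>S\<in>splits4. unsplit S a \<and> unsplit S b"
  by code_simp

text \<open>Three edges crossing every split form a spanning tree, and the product of the
  transpositions along a tree on four vertices is a 4-cycle. Its square moves every vertex, so
  looking at 0 is enough.\<close>

lemma three_edges: "\<forall>a\<in>edges4. \<forall>b\<in>edges4. \<forall>c\<in>edges4.
   tr c (tr b (tr a (tr c (tr b (tr a 0))))) = 0 \<longrightarrow>
   (\<exists>S\<in>splits4. unsplit S a \<and> unsplit S b \<and> unsplit S c)"
  by code_simp

text \<open>An instance of a Riemann-Hurwitz count: transpositions that act transitively on four
  points and multiply to the identity number at least six.\<close>

lemma four_edges: "\<forall>a\<in>edges4. \<forall>b\<in>edges4. \<forall>c\<in>edges4. \<forall>d\<in>edges4.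
   (\<forall>x\<in>set [0, 1, 2, 3]. tr d (tr c (tr b (tr a x))) = x) \<longrightarrow>
   (\<exists>S\<in>splits4. unsplit S a \<and> unsplit S b \<and> unsplit S c \<and> unsplit S d)"
  by code_simp

section \<open>Fixed vectors of products of reflections\<close>

text \<open>A square matrix is singular together with its transpose: \<open>n\<close> dependent
  vectors in dimension \<open>n\<close> do not span, so they have a common nonzero orthogonal
  vector.\<close>

lemma nontrivial_relation_imp_orthogonal:
  fixes a :: "nat \<Rightarrow> nat \<Rightarrow> complex"
  assumes rel: "\<And>i. i < n \<Longrightarrow> (\<Sum>t<n. y t * a t i) = 0" and nz: "s < n" "y s \<noteq> 0"
  obtains w i where "i < n" "w i \<noteq> 0" "\<And>t. t < n \<Longrightarrow> (\<Sum>i<n. a t i * w i) = 0"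
proof -
  define M where "M = mat n n (\<lambda>(t, i). a t i)"
  have M: "M \<in> carrier_mat n n" by (simp add: M_def)
  have "M\<^sup>T *\<^sub>v vec n y = 0\<^sub>v n"
  proof (rule eq_vecI)
    fix i assume i: "i < dim_vec (0\<^sub>v n :: complex vec)"
    then have "(M\<^sup>T *\<^sub>v vec n y) $ i = (\<Sum>t<n. y t * a t i)"
      by (simp add: M_def scalar_prod_def atLeast0LessThan mult.commute)
    then show "(M\<^sup>T *\<^sub>v vec n y) $ i = 0\<^sub>v n $ i" using rel i by simp
  qed (simp add: M_def)
  moreover have "vec n y \<noteq> 0\<^sub>v n"
    using nz by (auto simp: vec_eq_iff)
  ultimately have "det (M\<^sup>T) = 0"
    using det_0_iff_vec_prod_zero[of "M\<^sup>T" n] M vec_carrier[of n y] by (metis transpose_carrier_mat)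
  then have "det M = 0" using det_transpose[OF M] by simp
  then obtain w where w: "w \<in> carrier_vec n" "w \<noteq> 0\<^sub>v n" "M *\<^sub>v w = 0\<^sub>v n"
    using det_0_iff_vec_prod_zero[OF M] by auto
  then obtain i where "i < n" "w $ i \<noteq> 0" by (auto simp: vec_eq_iff)
  moreover have "(\<Sum>i<n. a t i * w $ i) = 0" if t: "t < n" for t
  proof -
    have "(M *\<^sub>v w) $ t = (\<Sum>i<n. a t i * w $ i)"
      using t w(1) by (simp add: M_def scalar_prod_def atLeast0LessThan)
    then show ?thesis using w(3) t by simp
  qed
  ultimately show ?thesis by (rule that)
qed

text \<open>Serves to turn \<open>n + 1\<close> roots, one of them with coefficient zero, into the
  \<open>n\<close> rows of a square matrix.\<close>

lemma reindex_skip: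
  fixes h :: "nat \<Rightarrow> 'a :: comm_monoid_add"
  assumes "r \<le> n"
  shows "(\<Sum>t<Suc n. h t) = h r + (\<Sum>s<n. h (if s < r then s else Suc s))"
proof -
  have "(\<Sum>s<n. h (if s < r then s else Suc s)) = sum h ({..<Suc n} - {r})"
    by (rule sum.reindex_bij_witness[of _ "\<lambda>t. if t < r then t else t - 1"
          "\<lambda>s. if s < r then s else Suc s"]) (use assms in auto)
  moreover have "(\<Sum>t<Suc n. h t) = h r + sum h ({..<Suc n} - {r})"
    using assms by (intro sum.remove) auto
  ultimately show ?thesis by simp
qed

text \<open>
  If \<open>v\<close> is fixed by the product, the displacements along the factors give a linear relation \<open>x t v\<close>
  between the roots \<open>a t\<close>, and the relation is trivial only if \<open>v\<close> is fixed by every factor. Two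
  independent fixed vectors can be combined to one whose relation omits some root, so the roots
  would not span.
\<close>
lemma reflections_fixed_dim_le_1:
  fixes B :: "nat \<Rightarrow> (nat \<Rightarrow> complex) \<Rightarrow> nat \<Rightarrow> complex"
    and f :: "nat \<Rightarrow> (nat \<Rightarrow> complex) \<Rightarrow> complex" and a :: "nat \<Rightarrow> nat \<Rightarrow> complex"
  assumes B: "\<And>t v i. t < Suc n \<Longrightarrow> B t v i = v i - f t v * a t i"
    and lin: "\<And>t v w c. t < Suc n \<Longrightarrow> f t (\<lambda>i. v i - c * w i) = f t v - c * f t w"
    and nofix: "\<And>v i. (\<And>t. t < Suc n \<Longrightarrow> f t v = 0) \<Longrightarrow> i < n \<Longrightarrow> v i = 0"
    and nocofix: "\<And>w i. (\<And>t. t < Suc n \<Longrightarrow> (\<Sum>i<n. a t i * w i) = 0) \<Longrightarrow> i < n \<Longrightarrow> w i = 0"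
    and v: "foldr B [0..<Suc n] v = v" and u: "foldr B [0..<Suc n] u = u"
  shows "(\<forall>i<n. v i = 0) \<or> (\<exists>c. \<forall>i<n. u i = c * v i)"
proof -
  let ?T = "Suc n"
  let ?F = "\<lambda>s. foldr B [s..<?T]"
  define x where "x t v = f t (?F (Suc t) v)" for t v
  have step: "?F s v = B s (?F (Suc s) v)" if "s < ?T" for s v
    using that by (simp add: upt_conv_Cons del: upt_Suc)
  have tele: "?F s v i = v i - (\<Sum>t=s..<?T. x t v * a t i)" if "s \<le> ?T" for s v i
    using that
  proof (induction rule: inc_induct)
    case (step m)
    then show ?case
      using \<open>\<And>s v. s < ?T \<Longrightarrow> ?F s v = B s (?F (Suc s) v)\<close>[of m v]
      by (simp add: B x_def sum.atLeast_Suc_lessThan del: upt_Suc sum.op_ivl_Suc)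
  qed simp
  have Flin: "?F s (\<lambda>i. v i - c * w i) = (\<lambda>i. ?F s v i - c * ?F s w i)" if "s \<le> ?T" for s v w c
    using that
  proof (induction rule: inc_induct)
    case (step m)
    then show ?case
      using \<open>\<And>s v. s < ?T \<Longrightarrow> ?F s v = B s (?F (Suc s) v)\<close>[of m]
      by (intro ext) (simp add: B lin algebra_simps del: upt_Suc)
  qed simp
  have xlin: "x t (\<lambda>i. v i - c * w i) = x t v - c * x t w" if "t < ?T" for t v w c
    using that unfolding x_def by (simp add: Flin lin del: upt_Suc)
  have rel: "(\<Sum>t<?T. x t v * a t i) = 0" if "?F 0 v = v" for v i
    using tele[of 0 v i] that by (simp add: atLeast0LessThan del: upt_Suc sum.lessThan_Suc)
  \<comment> \<open>Without displacements every partial product returns \<open>v\<close>, so each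
    functional is evaluated at \<open>v\<close> itself.\<close>
  have zero: "v i = 0" if "\<And>t. t < ?T \<Longrightarrow> x t v = 0" "i < n" for v i
  proof (rule nofix[OF _ \<open>i < n\<close>])
    fix t assume "t < ?T"
    then have "?F (Suc t) v = v" using tele[of "Suc t" v] that(1) by (intro ext) (simp del: upt_Suc)
    then show "f t v = 0" using that(1)[OF \<open>t < ?T\<close>] by (simp only: x_def)
  qed
  show ?thesis
  proof (cases "\<forall>t<?T. x t v = 0")
    case True
    then show ?thesis using zero[of v] by auto
  next
    case False
    then obtain r where r: "r < ?T" "x r v \<noteq> 0" by auto
    \<comment> \<open>Chosen so that the coefficient of root \<open>r\<close> vanishes for
      \<open>z\<close>.\<close>
    define c where "c = x r u / x r v"
    define z where "z = (\<lambda>i. u i - c * v i)"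
    have Fz: "?F 0 z = z" unfolding z_def by (subst Flin) (simp_all add: u v del: upt_Suc)
    have xr: "x r z = 0" unfolding z_def xlin[OF r(1)] using r by (simp add: c_def)
    have "\<forall>t<?T. x t z = 0"
    proof (rule ccontr)
      assume "\<not> (\<forall>t<?T. x t z = 0)"
      then obtain t0 where t0: "t0 < ?T" "x t0 z \<noteq> 0" by auto
      let ?g = "\<lambda>s. if s < r then s else Suc s"
      let ?s0 = "if t0 < r then t0 else t0 - 1"
      have "t0 \<noteq> r" using xr t0 by auto
      then have s0: "?s0 < n" "?g ?s0 = t0" using t0 r by auto
      have "(\<Sum>s<n. x (?g s) z * a (?g s) i) = 0" for i
        using rel[OF Fz, of i] reindex_skip[of r n "\<lambda>t. x t z * a t i"] r xr by simp
      then have rel': "(\<Sum>s<n. x (?g s) z * a (?g s) i) = 0" for i .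
      have nz: "x (?g ?s0) z \<noteq> 0" unfolding s0(2) by (rule t0(2))
      \<comment> \<open>The relation of \<open>z\<close> is nontrivial and involves only the
        \<open>n\<close> roots other than \<open>r\<close>.\<close>
      obtain w i where w: "i < n" "w i \<noteq> 0"
        and o: "\<And>s. s < n \<Longrightarrow> (\<Sum>i<n. a (?g s) i * w i) = 0"
        by (rule nontrivial_relation_imp_orthogonal
            [where y = "\<lambda>s. x (?g s) z" and a = "\<lambda>s. a (?g s)", OF rel' s0(1) nz]) (rule that)
      define h where "h t = (\<Sum>i<n. a t i * w i)" for t
      have o': "h t = 0" if "t < ?T" "t \<noteq> r" for t
      proof -
        let ?s = "if t < r then t else t - 1"
        have s: "?s < n" "?g ?s = t" using that r by auto
        show ?thesis using o[OF s(1)] unfolding h_def s(2) .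
      qed
      \<comment> \<open>Pairing the relation of \<open>v\<close> with \<open>w\<close> leaves only
        root \<open>r\<close>, whose coefficient is nonzero. So \<open>w\<close> is orthogonal to
        this root too, against \<open>nocofix\<close>.\<close>
      have "0 = (\<Sum>i<n. (\<Sum>t<?T. x t v * a t i) * w i)" using rel[OF v] by simp
      also have "\<dots> = (\<Sum>t<?T. x t v * h t)"
        unfolding h_def sum_distrib_left sum_distrib_right by (subst sum.swap) (simp only: mult.assoc)
      also have "\<dots> = x r v * h r"
        by (subst sum.remove[of _ r]) (use r o' in auto)
      finally have "h r = 0" using r by simp
      then have h0: "h t = 0" if "t < ?T" for t using o'[OF that] by (cases "t = r") auto
      have "w i = 0" by (rule nocofix[OF _ w(1)]) (use h0 in \<open>simp only: h_def\<close>)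
      then show False using w by simp
    qed
    then have "z i = 0" if "i < n" for i using zero[of z] that by blast
    then have "\<forall>i<n. u i = c * v i" by (simp add: z_def)
    then show ?thesis by blast
  qed
qed

section \<open>Elements of the groups\<close>

lemma GL_simps:
  "mult (GL n) = (*)" "one (GL n) = 1\<^sub>m n"
  by (simp_all add: units_of_mult units_of_one ring_mat_simps)

lemma GL_inv:
  assumes "A \<in> carrier (GL n)"
  shows "inv\<^bsub>GL n\<^esub> A * A = 1\<^sub>m n"
  using group.l_inv[OF group_GL assms] by (simp add: GL_simps)

context
  fixes n :: nat and H :: "complex mat set"
  assumes H: "H \<subseteq> carrier (GL n)"
    and mono: "\<And>A. A \<in> generate (GL n) H \<Longrightarrow> monomial_mat n A"
begin

lemma inv_generator:
  assumes "h \<in> H"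
  shows "monomial_mat n h" "monomial_mat n (inv\<^bsub>GL n\<^esub> h)" "inv\<^bsub>GL n\<^esub> h * h = 1\<^sub>m n"
  using assms H mono[OF generate.incl] mono[OF generate.inv] by (auto intro!: GL_inv)

text \<open>Common fixed vectors of the generators have to be excluded, whereas explicit matrices
  are at hand only in the whole group; this bridges the two.\<close>

lemma act_generate:
  assumes fixed: "\<And>A. A \<in> H \<Longrightarrow> act k A v = v" and "A \<in> generate (GL n) H"
  shows "act k A v = v"
  using assms(2)
proof (induction rule: generate.induct)
  case one
  then show ?case by (simp add: GL_simps act_one)
next
  case (incl h)
  then show ?case by (rule fixed)
next
  case (inv h)
  note h = inv_generator[OF inv]
  have "act k (inv\<^bsub>GL n\<^esub> h) v = act k (inv\<^bsub>GL n\<^esub> h * h) v"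
    by (simp add: act_mult[OF h(2,1)] fixed[OF inv])
  then show ?case by (simp add: h act_one)
next
  case (eng h1 h2)
  then show ?case by (simp add: GL_simps act_mult[OF mono mono])
qed

lemma prod_coef_generate:
  assumes one: "\<And>A. A \<in> H \<Longrightarrow> (\<Prod>i<n. coef A i) = 1" and "A \<in> generate (GL n) H"
  shows "(\<Prod>i<n. coef A i) = 1"
  using assms(2)
proof (induction rule: generate.induct)
  case one
  then show ?case by (simp add: GL_simps coef_one)
next
  case (incl h)
  then show ?case by (rule one)
next
  case (inv h)
  note h = inv_generator[OF inv]
  have "(\<Prod>i<n. coef (inv\<^bsub>GL n\<^esub> h) i) = (\<Prod>i<n. coef (inv\<^bsub>GL n\<^esub> h * h) i)"
    by (simp only: prod_coef_mult[OF h(2,1)] one[OF inv] mult_1_right)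
  then show ?case by (simp add: h coef_one)
next
  case (eng h1 h2)
  then show ?case by (simp only: GL_simps prod_coef_mult[OF mono mono] mult_1_right)
qed

end

lemma monomial_foldr:
  assumes "\<And>A. A \<in> set As \<Longrightarrow> monomial_mat n A"
  shows "monomial_mat n (foldr (*) As (1\<^sub>m n))"
    and "supp (foldr (*) As (1\<^sub>m n)) = foldr (\<lambda>A s. s \<circ> supp A) As id"
    and "act k (foldr (*) As (1\<^sub>m n)) v = foldr (act k) As v"
    and "(\<Prod>i<n. coef (foldr (*) As (1\<^sub>m n)) i) = (\<Prod>A\<leftarrow>As. \<Prod>i<n. coef A i)"
  using assms
proof (induction As)
  case Nil
  { case 1 show ?case by (simp add: monomial_one) }
  { case 2 show ?case by (simp add: supp_one) }
  { case 3 show ?case by (simp add: act_one) }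
  { case 4 show ?case by (simp add: coef_one) }
next
  case (Cons A As)
  have A: "monomial_mat n A" and M: "monomial_mat n (foldr (*) As (1\<^sub>m n))"
    if "\<And>B. B \<in> set (A # As) \<Longrightarrow> monomial_mat n B"
    using that Cons.IH(1) by auto
  { case 1 then show ?case using A M by (simp add: monomial_mult(1)) }
  { case 2
    have AM: "monomial_mat n A" "monomial_mat n (foldr (*) As (1\<^sub>m n))"
      using A[OF 2] M[OF 2] by auto
    show ?case using Cons.IH(2) 2 supp_mult[OF AM] by (simp add: comp_def) }
  { case 3
    have AM: "monomial_mat n A" "monomial_mat n (foldr (*) As (1\<^sub>m n))"
      using A[OF 3] M[OF 3] by auto
    show ?case using Cons.IH(3) 3 act_mult[OF AM] by simp }
  { case 4
    have AM: "monomial_mat n A" "monomial_mat n (foldr (*) As (1\<^sub>m n))"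
      using A[OF 4] M[OF 4] by auto
    show ?case using Cons.IH(4) 4 prod_coef_mult[OF AM] by simp }
qed

section \<open>Explicit elements: swaps and diagonal matrices\<close>

definition swap_mat :: "nat \<Rightarrow> nat \<Rightarrow> nat \<Rightarrow> complex \<Rightarrow> complex mat" where
  "swap_mat n i j c =
     gpm n (\<lambda>x. if x = i then c else if x = j then 1 / c else 1) (transpose i j)"

definition diag_mat2 :: "nat \<Rightarrow> nat \<Rightarrow> nat \<Rightarrow> complex \<Rightarrow> complex mat" where
  "diag_mat2 n i j c = gpm n (\<lambda>x. if x = i then c else if x = j then 1 / c else 1) id"

context
  fixes n i j :: nat and c :: complex
  assumes ij: "i < n" "j < n" "i \<noteq> j" and c: "c \<noteq> 0"
begin

lemma transpose_permutes: "transpose i j permutes {..<n}"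
  using ij by (intro permutes_swap_id) auto

lemma monomial_swap_mat: "monomial_mat n (swap_mat n i j c)"
  and supp_swap_mat: "supp (swap_mat n i j c) = transpose i j"
  and coef_swap_mat: "coef (swap_mat n i j c) x = (if x = i then c else if x = j then 1 / c else 1)"
  unfolding swap_mat_def using transpose_permutes ij c
  by (auto simp: monomial_gpm supp_gpm coef_gpm)

lemma monomial_diag_mat2: "monomial_mat n (diag_mat2 n i j c)"
  and supp_diag_mat2: "supp (diag_mat2 n i j c) = id"
  and coef_diag_mat2: "coef (diag_mat2 n i j c) x = (if x = i then c else if x = j then 1 / c else 1)"
  unfolding diag_mat2_def using permutes_id ij c
  by (auto simp: monomial_gpm supp_gpm coef_gpm)

lemma prod_pair: "(\<Prod>x<n. if x = i then c else if x = j then 1 / c else 1) = 1"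
proof -
  have "(\<Prod>x<n. if x = i then c else if x = j then 1 / c else 1) =
      (\<Prod>x\<in>{i, j}. if x = i then c else if x = j then 1 / c else 1)"
    using ij by (intro prod.mono_neutral_right) auto
  then show ?thesis using ij c by simp
qed

lemma swap_mat_Gmpn: "c ^ m = 1 \<Longrightarrow> swap_mat n i j c \<in> Gmpn m p n"
  unfolding Gmpn_iff coef_swap_mat prod_pair by (auto simp: monomial_swap_mat power_divide)

lemma diag_mat2_Gmpn: "c ^ m = 1 \<Longrightarrow> diag_mat2 n i j c \<in> Gmpn m p n"
  unfolding Gmpn_iff coef_diag_mat2 prod_pair by (auto simp: monomial_diag_mat2 power_divide)

end

text \<open>The diagonal matrix with \<open>z\<close> at \<open>i\<close> and \<open>1 / z\<close>
  at some \<open>j\<close> has entry product 1, so it lies in the group for every \<open>p\<close>.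
  With exponent \<open>k\<close> it scales coordinate \<open>i\<close> by \<open>z ^ k\<close>,
  which differs from 1.\<close>

lemma Gmpn_nofix:
  fixes z :: complex
  assumes "\<And>A. A \<in> Gmpn m p n \<Longrightarrow> act k A v = v" and "i < n" "n > 1"
    and z: "z ^ m = 1" "z ^ k \<noteq> 1" "z \<noteq> 0"
  shows "v i = 0"
proof -
  obtain j where j: "j < n" "i \<noteq> j" using assms(2,3) by (metis less_trans less_one not_less_iff_gr_or_eq)
  have "act k (diag_mat2 n i j z) v i = v i"
    using assms(1)[OF diag_mat2_Gmpn[OF \<open>i < n\<close> j z(3,1)]] by simp
  then have "z ^ k * v i = v i"
    using assms(2) j z(3) by (simp add: act_def coef_diag_mat2 supp_diag_mat2)
  then show ?thesis using z(2) by simp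
qed

lemma Gmpn_transitive:
  assumes "\<And>A. A \<in> Gmpn m p n \<Longrightarrow> act k A v = v" and "i < n" "j < n"
  shows "v i = v j"
proof (cases "i = j")
  case False
  have "act k (swap_mat n i j 1) v i = v i"
    using assms(1)[OF swap_mat_Gmpn[OF assms(2,3) False]] by simp
  then show ?thesis
    using assms(2,3) False by (simp add: act_def coef_swap_mat supp_swap_mat)
qed simp

lemma root_of_unity_exists:
  assumes "m > 0" "\<not> m dvd k"
  obtains z :: complex where "z ^ m = 1" "z ^ k \<noteq> 1" "z \<noteq> 0"
proof
  let ?z = "cis (2 * pi / real m)"
  have zk: "?z ^ k = cis (real k * (2 * pi / real m))" for k
    by (rule Complex.DeMoivre)
  show "?z ^ m = 1" using assms zk by simp
  show "?z \<noteq> 0" by simp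
  show "?z ^ k \<noteq> 1"
  proof
    assume "?z ^ k = 1"
    then obtain q where "real k * (2 * pi / real m) = of_int q * (2 * pi)"
      unfolding zk cis_eq_1_iff by auto
    then have "real k = of_int q * real m" using assms by (simp add: field_simps)
    then have "int k = q * int m" by (metis of_int_eq_iff of_int_mult of_int_of_nat_eq)
    then show False using assms(2) by (metis dvd_triv_right int_dvd_int_iff)
  qed
qed

section \<open>Transposition reflections and the fixed space of their products\<close>

definition transposition_reflection :: "complex mat \<Rightarrow> bool" where
  "transposition_reflection A \<longleftrightarrow> (\<exists>i j k l. {i, j, k, l} = {..<4} \<and>
     supp A i = j \<and> supp A j = i \<and> supp A k = k \<and> supp A l = l \<and>
     coef A i * coef A j = 1 \<and> coef A k = 1 \<and> coef A l = 1)"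

text \<open>The two moved points come out ordered because \<open>edges4\<close> lists only
  increasing pairs.\<close>

lemma transposition_reflectionE:
  assumes "transposition_reflection A" "monomial_mat 4 A"
  obtains i j where "i < j" "j < 4" "supp A = transpose i j" "coef A i * coef A j = 1"
    "\<And>x. x \<noteq> i \<Longrightarrow> x \<noteq> j \<Longrightarrow> coef A x = 1"
proof -
  obtain i j k l where s: "{i, j, k, l} = {..<4}"
    and *: "supp A i = j" "supp A j = i" "supp A k = k" "supp A l = l"
      "coef A i * coef A j = 1" "coef A k = 1" "coef A l = 1"
    using assms(1) unfolding transposition_reflection_def by auto
  have x: "x = i \<or> x = j \<or> x = k \<or> x = l \<or> x \<noteq> i \<and> x \<noteq> j \<and> supp A x = x \<and> coef A x = 1" for x
  proof (cases "x < 4")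
    case True
    then have "x \<in> {i, j, k, l}" unfolding s by simp
    then show ?thesis by auto
  next
    case False
    then show ?thesis
      using coef_ge[OF assms(2)] permutes_not_in[OF supp_permutes[OF assms(2)], of x] four_lt[OF s]
      by simp
  qed
  have t: "supp A = transpose i j"
  proof
    fix y
    show "supp A y = transpose i j y"
      using x[of y] * four_distinct[OF s] by (elim disjE) (simp_all add: transpose_def)
  qed
  have c: "coef A y = 1" if "y \<noteq> i" "y \<noteq> j" for y
    using x[of y] *(6,7) that by (elim disjE) simp_all
  have lt: "i < 4" "j < 4" "i \<noteq> j" using four_lt[OF s] four_distinct[OF s] by auto
  show ?thesis
  proof (cases "i < j")
    case True
    then show ?thesis by (rule that[OF _ lt(2) t *(5) c])
  next
    case False
    then have "j < i" using lt by simp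
    moreover have "supp A = transpose j i" "coef A j * coef A i = 1"
      using t *(5) by (simp_all add: transpose_commute mult.commute)
    ultimately show ?thesis using lt(1) c by (intro that[of j i])
  qed
qed

lemma prod_coef_transposition:
  assumes "transposition_reflection A" "monomial_mat 4 A"
  shows "(\<Prod>i<4. coef A i) = 1"
proof -
  obtain i j where ij: "i < j" "j < 4" "coef A i * coef A j = 1"
    and c: "\<And>x. x \<noteq> i \<Longrightarrow> x \<noteq> j \<Longrightarrow> coef A x = 1"
    using transposition_reflectionE[OF assms] by metis
  have "(\<Prod>x<4. coef A x) = (\<Prod>x\<in>{i, j}. coef A x)"
    using ij c by (intro prod.mono_neutral_right) auto
  then show ?thesis using ij by simp
qed

text \<open>
  The functional \<open>f\<close> and the root \<open>a\<close> of the reflection that \<open>A\<close> induces on the entrywise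
  \<open>k\<close>-th power representation. As the \<open>(k + k')\<close>-th powers of the entries are \<open>1\<close>, exponent \<open>k'\<close> describes
  the dual representation.
\<close>
lemma reflection_decomposition:
  assumes A: "monomial_mat 4 A" and "transposition_reflection A \<or> A = 1\<^sub>m 4"
    and kk: "\<And>x. coef A x ^ (k + k') = 1"
  obtains f a where "\<And>v x. act k A v x = v x - f v * a x"
    "\<And>v w c. f (\<lambda>i. v i - c * w i) = f v - c * f w"
    "\<And>w. (\<Sum>x<4. a x * w x) = 0 \<Longrightarrow> act k' A w = w"
  using assms(2)
proof
  assume "A = 1\<^sub>m 4"
  then show ?thesis by (intro that[of "\<lambda>_. 0" "\<lambda>_. 0"]) (auto simp: act_one)
next
  assume "transposition_reflection A"
  then obtain i j where ij: "i < j" "j < 4" and t: "supp A = transpose i j"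
    and cij: "coef A i * coef A j = 1" and c: "\<And>x. x \<noteq> i \<Longrightarrow> x \<noteq> j \<Longrightarrow> coef A x = 1"
    by (rule transposition_reflectionE[OF _ A]) (rule that)
  define d where "d = coef A i ^ k"
  have nz: "d \<noteq> 0" using coef_nz[OF A] by (simp add: d_def)
  have "d * coef A j ^ k = 1" unfolding d_def power_mult_distrib[symmetric] cij by simp
  then have dj: "coef A j ^ k = 1 / d" using nz by (simp add: field_simps)
  have di': "coef A i ^ k' = 1 / d"
    using kk[of i] nz unfolding power_add d_def[symmetric] by (simp add: field_simps)
  have dj': "coef A j ^ k' = d"
    using kk[of j] nz unfolding power_add dj by (simp add: field_simps)
  \<comment> \<open>The operator takes coordinates \<open>v i\<close>, \<open>v j\<close> to
    \<open>d * v j\<close>, \<open>v i / d\<close>. So \<open>v\<close> minus its image is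
    \<open>v i - d * v j\<close> times the vector with 1 at \<open>i\<close> and
    \<open>- 1 / d\<close> at \<open>j\<close>.\<close>
  define a where "a x = (if x = i then 1 else if x = j then - 1 / d else 0 :: complex)" for x
  show ?thesis
  proof (rule that[of "\<lambda>v. v i - d * v j" a])
    show "act k A v x = v x - (v i - d * v j) * a x" for v x
      using ij nz c[of x] by (auto simp: act_def t a_def dj d_def[symmetric] field_simps)
    show "v i - c * w i - d * (v j - c * w j) = v i - d * v j - c * (w i - d * w j)" for v w c
      by (simp add: algebra_simps)
  next
    fix w :: "nat \<Rightarrow> complex" assume 0: "(\<Sum>x<4. a x * w x) = 0"
    have "(\<Sum>x<4. a x * w x) = (\<Sum>x\<in>{i, j}. a x * w x)"
      using ij by (intro sum.mono_neutral_right) (auto simp: a_def)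
    also have "\<dots> = w i - w j / d" using ij by (simp add: a_def)
    finally have "w j = d * w i" using 0 nz by (simp add: field_simps)
    then show "act k' A w = w"
      using ij nz c by (intro ext) (auto simp: act_def t di' dj' transpose_def)
  qed
qed

lemma product_fixed_dim_le_1:
  assumes As: "length As \<le> 5" "\<And>A. A \<in> set As \<Longrightarrow> monomial_mat 4 A"
      "\<And>A. A \<in> set As \<Longrightarrow> transposition_reflection A"
    and kk: "\<And>A x. A \<in> set As \<Longrightarrow> coef A x ^ (k + k') = 1"
    and nofix: "\<And>v i. (\<And>A. A \<in> set As \<Longrightarrow> act k A v = v) \<Longrightarrow> i < 4 \<Longrightarrow> v i = 0"
    and nofix': "\<And>v i. (\<And>A. A \<in> set As \<Longrightarrow> act k' A v = v) \<Longrightarrow> i < 4 \<Longrightarrow> v i = 0"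
    and v: "act k (foldr (*) As (1\<^sub>m 4)) v = v" and u: "act k (foldr (*) As (1\<^sub>m 4)) u = u"
  shows "(\<forall>i<4. v i = 0) \<or> (\<exists>c. \<forall>i<4. u i = c * v i)"
proof -
  \<comment> \<open>The bound on the fixed space speaks of exactly 4 + 1 factors. Shorter tuples are
    filled up with identities, which act as reflections with zero functional and zero root.\<close>
  define Bs where "Bs = As @ replicate (5 - length As) (1\<^sub>m 4)"
  have len: "length Bs = Suc 4" using As(1) by (simp add: Bs_def)
  have Bs: "B \<in> set As \<or> B = 1\<^sub>m 4" if "B \<in> set Bs" for B using that by (auto simp: Bs_def)
  have foldr_Bs: "foldr (\<lambda>t. act k (Bs ! t)) [0..<Suc 4] w = act k (foldr (*) As (1\<^sub>m 4)) w" for w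
  proof -
    have one: "foldr (act k) (replicate q (1\<^sub>m 4)) w = w" for q
      by (induction q) (simp_all add: act_one)
    have "foldr (\<lambda>t. act k (Bs ! t)) [0..<Suc 4] w = foldr (act k) (map ((!) Bs) [0..<length Bs]) w"
      unfolding foldr_map len comp_def ..
    also have "\<dots> = foldr (act k) As w"
      unfolding map_nth Bs_def foldr_append one ..
    finally show ?thesis using monomial_foldr(3)[of As 4 k w, OF As(2)] by simp
  qed
  \<comment> \<open>Functional and root are bundled in a pair, so that one application of choice
    selects both for every factor.\<close>
  define Q where "Q B p \<longleftrightarrow> (\<forall>v x. act k B v x = v x - fst p v * snd p x) \<and>
     (\<forall>v w c. fst p (\<lambda>i. v i - c * w i) = fst p v - c * fst p w) \<and>
     (\<forall>w. (\<Sum>x<4. snd p x * w x) = 0 \<longrightarrow> act k' B w = w)"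
    for B and p :: "((nat \<Rightarrow> complex) \<Rightarrow> complex) \<times> (nat \<Rightarrow> complex)"
  have "\<forall>t. \<exists>p. t < Suc 4 \<longrightarrow> Q (Bs ! t) p"
  proof
    fix t :: nat
    show "\<exists>p. t < Suc 4 \<longrightarrow> Q (Bs ! t) p"
    proof (cases "t < Suc 4")
      case True
      then have B: "Bs ! t \<in> set As \<or> Bs ! t = 1\<^sub>m 4" using Bs len by simp
      have m: "monomial_mat 4 (Bs ! t)" using B As(2) monomial_one[of 4] by auto
      have r: "transposition_reflection (Bs ! t) \<or> Bs ! t = 1\<^sub>m 4" using B As(3) by auto
      have k: "coef (Bs ! t) x ^ (k + k') = 1" for x
        using B kk[of "Bs ! t" x] by (auto simp: coef_one)
      obtain f a where "\<And>v x. act k (Bs ! t) v x = v x - f v * a x"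
        "\<And>v w c. f (\<lambda>i. v i - c * w i) = f v - c * f w"
        "\<And>w. (\<Sum>x<4. a x * w x) = 0 \<Longrightarrow> act k' (Bs ! t) w = w"
        by (rule reflection_decomposition[OF m r k]) (rule that)
      then have "Q (Bs ! t) (f, a)" unfolding Q_def fst_conv snd_conv by (intro conjI allI impI)
      then show ?thesis by blast
    qed simp
  qed
  from choice[OF this] obtain g where g: "\<And>t. t < Suc 4 \<Longrightarrow> Q (Bs ! t) (g t)" by blast
  have f: "act k (Bs ! t) v x = v x - fst (g t) v * snd (g t) x"
    and lin: "fst (g t) (\<lambda>i. v i - c * w i) = fst (g t) v - c * fst (g t) w"
    and cof: "(\<Sum>x<4. snd (g t) x * w x) = 0 \<Longrightarrow> act k' (Bs ! t) w = w"
    if "t < Suc 4" for t v w x c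
    using g[OF that] unfolding Q_def by blast+
  have idx: "\<exists>t<Suc 4. A = Bs ! t" if "A \<in> set As" for A
  proof -
    have "A \<in> set Bs" using that by (simp add: Bs_def)
    then show ?thesis by (metis in_set_conv_nth len)
  qed
  show ?thesis
  proof (rule reflections_fixed_dim_le_1[where B = "\<lambda>t. act k (Bs ! t)" and f = "\<lambda>t. fst (g t)"
        and a = "\<lambda>t. snd (g t)"])
    fix v :: "nat \<Rightarrow> complex" and i :: nat
    assume 0: "\<And>t. t < Suc 4 \<Longrightarrow> fst (g t) v = 0" and i: "i < 4"
    have "act k (Bs ! t) v = v" if "t < Suc 4" for t
      by (rule ext) (simp only: f[OF that] 0[OF that] mult_zero_left diff_zero)
    then have "act k A v = v" if "A \<in> set As" for A using idx[OF that] by auto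
    then show "v i = 0" using i by (rule nofix)
  next
    fix v :: "nat \<Rightarrow> complex" and i :: nat
    assume 0: "\<And>t. t < Suc 4 \<Longrightarrow> (\<Sum>i<4. snd (g t) i * v i) = 0" and i: "i < 4"
    have "act k' (Bs ! t) v = v" if "t < Suc 4" for t by (rule cof[OF that 0[OF that]])
    then have "act k' A v = v" if "A \<in> set As" for A using idx[OF that] by auto
    then show "v i = 0" using i by (rule nofix')
  next
    show "foldr (\<lambda>t. act k (Bs ! t)) [0..<Suc 4] v = v" unfolding foldr_Bs by (rule v)
    show "foldr (\<lambda>t. act k (Bs ! t)) [0..<Suc 4] u = u" unfolding foldr_Bs by (rule u)
  qed (rule f lin, assumption)+
qed

section \<open>Cycle types of the product\<close>

lemma prod_four:
  assumes "{i, j, k, l} = {..<4::nat}"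
  shows "prod f {..<4} = f i * f j * f k * (f l :: 'a :: comm_monoid_mult)"
  unfolding assms[symmetric] using four_distinct[OF assms] by (simp add: mult.assoc)

lemma four_elim:
  assumes "{i, j, k, l} = {..<4::nat}" "x < 4"
  shows "x = i \<or> x = j \<or> x = k \<or> x = l"
proof -
  have "x \<in> {i, j, k, l}" unfolding assms(1) using assms(2) by simp
  then show ?thesis by simp
qed

lemma perm4_eqI:
  assumes s: "{i, j, k, l} = {..<4::nat}" and p: "\<sigma> permutes {..<4}" "\<tau> permutes {..<4}"
    and eq: "\<sigma> i = \<tau> i" "\<sigma> j = \<tau> j" "\<sigma> k = \<tau> k" "\<sigma> l = \<tau> l"
  shows "\<sigma> = \<tau>"
proof
  fix x
  show "\<sigma> x = \<tau> x"
  proof (cases "x < 4")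
    case True
    then show ?thesis using four_elim[OF s] eq by metis
  next
    case False
    then show ?thesis using permutes_not_in[OF p(1), of x] permutes_not_in[OF p(2), of x] by simp
  qed
qed

lemma act_eqI:
  assumes N: "monomial_mat 4 N" and s: "{i, j, k, l} = {..<4::nat}"
    and eq: "act q N v i = v i" "act q N v j = v j" "act q N v k = v k" "act q N v l = v l"
  shows "act q N v = v"
proof
  fix x
  show "act q N v x = v x"
  proof (cases "x < 4")
    case True
    then show ?thesis using four_elim[OF s] eq by metis
  next
    case False
    then show ?thesis
      using permutes_not_in[OF supp_permutes[OF N], of x] coef_ge[OF N, of x] by (simp add: act_def)
  qed
qed

lemma swaps_permute: "a < 4 \<Longrightarrow> b < 4 \<Longrightarrow> transpose a b permutes {..<4::nat}"
  by (intro permutes_swap_id) auto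

section \<open>Signs of the cycle types, and fixed vectors of the fourth powers\<close>

context
  fixes \<sigma> :: "nat \<Rightarrow> nat" and i j k l :: nat
  assumes p: "\<sigma> permutes {..<4}" and s: "{i, j, k, l} = {..<4::nat}"
begin

lemma sign_transposition:
  assumes "\<sigma> i = j" "\<sigma> j = i" "\<sigma> k = k" "\<sigma> l = l"
  shows "sign \<sigma> = -1"
proof -
  note d = four_distinct[OF s] and lt = four_lt[OF s]
  have "\<sigma> = transpose i j"
    by (rule perm4_eqI[OF s p swaps_permute[OF lt(1,2)]]) (use assms d in auto)
  then show ?thesis using d by (simp add: sign_swap_id)
qed

lemma sign_double_transposition:
  assumes "\<sigma> i = j" "\<sigma> j = i" "\<sigma> k = l" "\<sigma> l = k"
  shows "sign \<sigma> = 1"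
proof -
  note d = four_distinct[OF s] and lt = four_lt[OF s]
  have "\<sigma> = transpose i j \<circ> transpose k l"
    by (rule perm4_eqI[OF s p permutes_compose[OF swaps_permute swaps_permute]])
      (use assms d lt in auto)
  then show ?thesis using d by (simp add: sign_compose sign_swap_id permutation_swap_id)
qed

lemma sign_3_cycle:
  assumes "\<sigma> i = j" "\<sigma> j = k" "\<sigma> k = i" "\<sigma> l = l"
  shows "sign \<sigma> = 1"
proof -
  note d = four_distinct[OF s] and lt = four_lt[OF s]
  have "\<sigma> = transpose i j \<circ> transpose j k"
    by (rule perm4_eqI[OF s p permutes_compose[OF swaps_permute swaps_permute]])
      (use assms d lt in auto)
  then show ?thesis using d by (simp add: sign_compose sign_swap_id permutation_swap_id)
qed

end

text \<open>Shaped as the negation of what \<open>product_fixed_dim_le_1\<close> concludes. Only the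
  first four coordinates are compared, since a monomial matrix of size 4 leaves the others
  alone.\<close>

definition two_fixed_vectors :: "nat \<Rightarrow> complex mat \<Rightarrow> bool" where
  "two_fixed_vectors q N \<longleftrightarrow> (\<exists>v u. act q N v = v \<and> act q N u = u \<and>
     \<not> (\<forall>i<4. v i = 0) \<and> \<not> (\<exists>c. \<forall>i<4. u i = c * v i))"

lemma two_fixed_vectorsI:
  assumes "act q N v = v" "act q N u = u" "i < 4" "j < 4" "v i \<noteq> 0" "v j = 0" "u j \<noteq> 0"
  shows "two_fixed_vectors q N"
  unfolding two_fixed_vectors_def using assms by (intro exI[of _ v] exI[of _ u]) force

context
  fixes N :: "complex mat" and i j k l :: nat and x :: complex
  assumes N: "monomial_mat 4 N" and s: "{i, j, k, l} = {..<4::nat}"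
    and prod: "(\<Prod>i<4. coef N i) = 1"
begin

lemma prod_N: "coef N i * coef N j * coef N k * coef N l = 1"
  using prod unfolding prod_four[OF s] .

text \<open>Multiplicity 3 engages all three cycles: \<open>x\<close> equals both fixed entries and
  \<open>x ^ 2\<close> the product of the 2-cycle. Multiplied together, \<open>x ^ 4\<close> is the
  entry product 1, so the unit vectors at \<open>k\<close> and \<open>l\<close> are fixed.\<close>

lemma two_fixed_vectors_transposition:
  assumes *: "supp N i = j" "supp N j = i" "supp N k = k" "supp N l = l"
    and "eigenvalue_mult N x = 3"
  shows "two_fixed_vectors 4 N"
proof -
  note d = four_distinct[OF s] and lt = four_lt[OF s]
  have e: "x ^ 2 = coef N i * coef N j" "x = coef N k" "x = coef N l"
    using assms(5) unfolding eigenvalue_mult_transposition[OF N s *]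
    by (auto simp: of_bool_def split: if_splits)
  have "x ^ 4 = x ^ 2 * x * x" by (simp add: power2_eq_square power4_eq_xxxx)
  also have "\<dots> = 1" using prod_N e by metis
  finally have 4: "coef N k ^ 4 = 1" "coef N l ^ 4 = 1" using e by auto
  show ?thesis
  proof (rule two_fixed_vectorsI[OF _ _ lt(3,4)])
    show "act 4 N (\<lambda>y. of_bool (y = k)) = (\<lambda>y. of_bool (y = k))"
      by (rule act_eqI[OF N s]) (use d 4 * in \<open>simp_all add: act_def\<close>)
    show "act 4 N (\<lambda>y. of_bool (y = l)) = (\<lambda>y. of_bool (y = l))"
      by (rule act_eqI[OF N s]) (use d 4 * in \<open>simp_all add: act_def\<close>)
  qed (use d in auto)
qed

lemma two_fixed_vectors_double_transposition:
  assumes *: "supp N i = j" "supp N j = i" "supp N k = l" "supp N l = k"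
    and "eigenvalue_mult N x = 2"
  shows "two_fixed_vectors 4 N"
proof -
  note d = four_distinct[OF s] and lt = four_lt[OF s]
  have e: "x ^ 2 = coef N i * coef N j" "x ^ 2 = coef N k * coef N l"
    using assms(5) unfolding eigenvalue_mult_double_transposition[OF N s *]
    by (auto simp: of_bool_def split: if_splits)
  have "x ^ 2 * x ^ 2 = coef N i * coef N j * coef N k * coef N l"
    using e by (metis mult.assoc)
  then have "x ^ 2 * x ^ 2 = 1" using prod_N by simp
  then have x4: "(x ^ 2) ^ 4 = 1" unfolding power4_eq_xxxx by (simp only: mult_1_left)
  have 4: "coef N i ^ 4 * coef N j ^ 4 = 1" "coef N k ^ 4 * coef N l ^ 4 = 1"
    using x4 e by (metis power_mult_distrib)+
  show ?thesis
  proof (rule two_fixed_vectorsI[OF _ _ lt(1,3)])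
    \<comment> \<open>With coordinate \<open>j\<close> set to 1, row \<open>i\<close> forces the
      value at \<open>i\<close>; row \<open>j\<close> then holds because the fourth power of the
      cycle product is 1.\<close>
    show "act 4 N (\<lambda>y. if y = i then coef N i ^ 4 else of_bool (y = j)) =
        (\<lambda>y. if y = i then coef N i ^ 4 else of_bool (y = j))"
      by (rule act_eqI[OF N s]) (use d 4 * in \<open>simp_all add: act_def mult.commute\<close>)
    show "act 4 N (\<lambda>y. if y = k then coef N k ^ 4 else of_bool (y = l)) =
        (\<lambda>y. if y = k then coef N k ^ 4 else of_bool (y = l))"
      by (rule act_eqI[OF N s]) (use d 4 * in \<open>simp_all add: act_def mult.commute\<close>)
  qed (use d coef_nz[OF N] in auto)
qed

lemma two_fixed_vectors_3_cycle:
  assumes *: "supp N i = j" "supp N j = k" "supp N k = i" "supp N l = l"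
    and "eigenvalue_mult N x = 2"
  shows "two_fixed_vectors 4 N"
proof -
  note d = four_distinct[OF s] and lt = four_lt[OF s]
  have e: "x ^ 3 = coef N i * coef N j * coef N k" "x = coef N l"
    using assms(5) unfolding eigenvalue_mult_3_cycle[OF N s *]
    by (auto simp: of_bool_def split: if_splits)
  have "x ^ 4 = x ^ 3 * x" by (simp add: power3_eq_cube power4_eq_xxxx)
  also have "\<dots> = 1" using prod_N e by metis
  finally have l4: "coef N l ^ 4 = 1" using e by simp
  \<comment> \<open>The 3-cycle has entry product \<open>x ^ 3\<close> with
    \<open>x = coef N l\<close>, so its fourth power is the cube of
    \<open>x ^ 4 = 1\<close>.\<close>
  have "(coef N l ^ 4) ^ 3 = (coef N i * coef N j * coef N k) ^ 4"
    unfolding e(1)[symmetric] e(2)[symmetric] by (simp flip: power_mult)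
  then have 4: "coef N k ^ 4 * (coef N i ^ 4 * coef N j ^ 4) = 1"
    unfolding l4 by (simp add: power_mult_distrib mult.commute mult.left_commute)
  show ?thesis
  proof (rule two_fixed_vectorsI[OF _ _ lt(3,4)])
    show "act 4 N (\<lambda>y. if y = i then coef N i ^ 4 * coef N j ^ 4
          else if y = j then coef N j ^ 4 else of_bool (y = k)) =
        (\<lambda>y. if y = i then coef N i ^ 4 * coef N j ^ 4
          else if y = j then coef N j ^ 4 else of_bool (y = k))"
      by (rule act_eqI[OF N s]) (use d 4 * in \<open>simp_all add: act_def\<close>)
    show "act 4 N (\<lambda>y. of_bool (y = l)) = (\<lambda>y. of_bool (y = l))"
      by (rule act_eqI[OF N s]) (use d l4 * in \<open>simp_all add: act_def\<close>)
  qed (use d in auto)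
qed

end

section \<open>Words in transpositions and the cycle type of the inverse product\<close>

abbreviation (input) edge_word :: "(nat \<times> nat) list \<Rightarrow> nat \<Rightarrow> nat" where
  "edge_word es \<equiv> foldr (\<lambda>e s. s \<circ> transpose (fst e) (snd e)) es id"

lemma edge_word_sign:
  assumes "\<And>e. e \<in> set es \<Longrightarrow> fst e \<noteq> snd e"
  shows "permutation (edge_word es) \<and> sign (edge_word es) = (-1) ^ length es"
  using assms
  by (induction es) (auto simp: sign_compose sign_swap_id permutation_swap_id permutation_compose)

lemma connected_edge_words:
  assumes es: "set es \<subseteq> edges4" and conn: "\<And>S. S \<in> splits4 \<Longrightarrow> \<exists>e\<in>set es. \<not> unsplit S e"
  shows "length es \<ge> 3"
    and "length es = 3 \<Longrightarrow> edge_word es (edge_word es 0) \<noteq> 0"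
    and "length es = 4 \<Longrightarrow> edge_word es \<noteq> id"
proof -
  have False if two: "\<exists>a\<in>edges4. \<exists>b\<in>edges4. set es \<subseteq> {a, b}"
  proof -
    obtain a b where "a \<in> edges4" "b \<in> edges4" and ab: "set es \<subseteq> {a, b}" using two by blast
    then obtain S where S: "S \<in> splits4" "unsplit S a" "unsplit S b" using two_edges by blast
    show False using conn[OF S(1)] S(2,3) ab by blast
  qed
  note two = this
  show "length es \<ge> 3"
  proof (rule ccontr)
    assume *: "\<not> 3 \<le> length es"
    consider "es = []" | a where "es = [a]" | a b where "es = [a, b]"
    proof -
      have "length es = 0 \<or> length es = Suc 0 \<or> length es = Suc (Suc 0)" using * by linarith
      then show ?thesis using that unfolding length_Suc_conv length_0_conv by blast
    qed
    then show False
    proof cases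
      case 1
      have e: "(0, 1) \<in> edges4" by simp
      show ?thesis by (rule two) (intro bexI[OF _ e], simp add: 1)
    next
      case 2
      show ?thesis by (rule two) (use es in \<open>unfold 2, simp only: list.set, blast\<close>)
    next
      case 3
      show ?thesis by (rule two) (use es in \<open>unfold 3, simp only: list.set, blast\<close>)
    qed
  qed
  show "edge_word es (edge_word es 0) \<noteq> 0" if "length es = 3"
  proof
    assume 0: "edge_word es (edge_word es 0) = 0"
    obtain a b c where abc: "es = [a, b, c]"
      using \<open>length es = 3\<close> by (auto simp: numeral_eq_Suc length_Suc_conv)
    then have "a \<in> edges4" "b \<in> edges4" "c \<in> edges4" using es by (simp_all only: list.set insert_subset)
    moreover have "tr c (tr b (tr a (tr c (tr b (tr a 0))))) = 0" using 0 unfolding abc by simp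
    ultimately obtain S where S: "S \<in> splits4" "unsplit S a" "unsplit S b" "unsplit S c"
      using three_edges by blast
    show False using conn[OF S(1)] S(2-4) unfolding abc by auto
  qed
  show "edge_word es \<noteq> id" if "length es = 4"
  proof
    assume id: "edge_word es = id"
    obtain a b c d where abcd: "es = [a, b, c, d]"
      using \<open>length es = 4\<close> by (auto simp: numeral_eq_Suc length_Suc_conv)
    then have "a \<in> edges4" "b \<in> edges4" "c \<in> edges4" "d \<in> edges4"
      using es by (simp_all only: list.set insert_subset)
    moreover have "tr d (tr c (tr b (tr a x))) = x" for x
      using fun_cong[OF id, of x] unfolding abcd by simp
    ultimately obtain S where S: "S \<in> splits4" "unsplit S a" "unsplit S b" "unsplit S c" "unsplit S d"
      using four_edges by blast
    show False using conn[OF S(1)] S(2-5) unfolding abcd by auto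
  qed
qed

text \<open>A diagonal factor has \<open>supp A = id\<close> and drops out of the permutation, so
  only the transpositions among the factors count.\<close>

lemma foldr_supp_edge_word:
  assumes "\<And>A. A \<in> set As \<Longrightarrow> supp A \<noteq> id \<Longrightarrow> supp A = transpose (fst (e A)) (snd (e A))"
  shows "foldr (\<lambda>A s. s \<circ> supp A) As id = edge_word (map e (filter (\<lambda>A. supp A \<noteq> id) As))"
  using assms
proof (induction As)
  case (Cons A As)
  have IH: "foldr (\<lambda>A s. s \<circ> supp A) As id = edge_word (map e (filter (\<lambda>A. supp A \<noteq> id) As))"
    by (rule Cons.IH, rule Cons.prems) simp_all
  have step: "foldr (\<lambda>A s. s \<circ> supp A) (A # As) id = foldr (\<lambda>A s. s \<circ> supp A) As id \<circ> supp A"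
    by simp
  have step2: "edge_word (d # ds) = edge_word ds \<circ> transpose (fst d) (snd d)"
    for d :: "nat \<times> nat" and ds
    by simp
  show ?case
  proof (cases "supp A = id")
    case True
    then have "filter (\<lambda>A. supp A \<noteq> id) (A # As) = filter (\<lambda>A. supp A \<noteq> id) As" by simp
    then show ?thesis unfolding step IH True by (simp only: o_id)
  next
    case False
    then have *: "filter (\<lambda>A. supp A \<noteq> id) (A # As) = A # filter (\<lambda>A. supp A \<noteq> id) As" by simp
    have "supp A = transpose (fst (e A)) (snd (e A))" by (rule Cons.prems[OF _ False]) simp
    then show ?thesis unfolding step IH * list.map step2 by (simp only:)
  qed
qed simp

lemma splits4_split: "\<forall>S\<in>splits4. \<exists>i\<in>set [0, 1, 2, 3]. \<exists>j\<in>set [0, 1, 2, 3]. i \<in> set S \<and> j \<notin> set S"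
  by code_simp

text \<open>Entries are \<open>m\<close>-th roots of unity, so \<open>act m\<close> merely permutes
  coordinates. If no generator crossed the split, the indicator of \<open>S\<close> would be fixed
  by the generators, hence by the group, which is transitive on coordinates.\<close>

lemma generators_cross_split:
  assumes H: "H \<subseteq> carrier (GL 4)" and gen: "generate (GL 4) H = Gmpn m p 4" and S: "S \<in> splits4"
  shows "\<exists>A\<in>H. \<exists>x<4. (x \<in> set S) \<noteq> (supp A x \<in> set S)"
proof (rule ccontr)
  assume *: "\<not> ?thesis"
  have mono: "monomial_mat 4 A" if "A \<in> generate (GL 4) H" for A
    using that unfolding gen Gmpn_iff by blast
  define v :: "nat \<Rightarrow> complex" where "v x = of_bool (x \<in> set S)" for x
  have fixedH: "act m A v = v" if A: "A \<in> H" for A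
  proof
    fix x
    have AG: "A \<in> Gmpn m p 4" unfolding gen[symmetric] by (rule generate.incl[OF A])
    then have mA: "monomial_mat 4 A" by (simp add: Gmpn_iff)
    show "act m A v x = v x"
    proof (cases "x < 4")
      case True
      then have "coef A x ^ m = 1" using AG by (simp add: Gmpn_iff)
      moreover have "(x \<in> set S) = (supp A x \<in> set S)" using * A True by blast
      ultimately show ?thesis by (simp add: act_def v_def)
    next
      case False
      then show ?thesis
        using permutes_not_in[OF supp_permutes[OF mA], of x] coef_ge[OF mA, of x] by (simp add: act_def)
    qed
  qed
  have fixed: "act m A v = v" if "A \<in> Gmpn m p 4" for A
  proof (rule act_generate[OF H mono])
    show "A \<in> generate (GL 4) H" unfolding gen by (rule that)
  qed (assumption | rule fixedH)+
  obtain i j where ij: "i \<in> set [0, 1, 2, 3]" "j \<in> set [0, 1, 2, 3]" "i \<in> set S" "j \<notin> set S"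
    using splits4_split S by blast
  have "i < 4" "j < 4" using ij(1,2) by auto
  from Gmpn_transitive[OF fixed this] show False using ij(3,4) by (simp add: v_def)
qed

text \<open>Here \<open>t\<close> counts the transpositions among the \<open>T\<close> factors. By
  parity, a transposition needs \<open>t\<close> odd and the identity, a double transposition or a
  3-cycle need \<open>t = 4\<close>. \<open>t3\<close> excludes the transposition for
  \<open>t = 3\<close> and \<open>t4\<close> the identity. An eigenvalue occurs at most once per
  cycle, which excludes the 4-cycle, and for \<open>T = 5\<close> also the types with two cycles.
  All that remains has \<open>t = T\<close>.\<close>

lemma perm_cycle_type_constraints:
  assumes T: "T = 4 \<or> T = 5" and M: "\<sigma> permutes {..<4}" and N: "monomial_mat 4 N"
    and inv: "\<sigma> \<circ> supp N = id" and mult: "eigenvalue_mult N x = T - 2"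
    and t: "3 \<le> t" "t \<le> T" and sg: "sign \<sigma> = (-1) ^ t"
    and t3: "t = 3 \<Longrightarrow> \<sigma> (\<sigma> 0) \<noteq> 0" and t4: "t = 4 \<Longrightarrow> \<sigma> \<noteq> id"
    and prod: "t = T \<Longrightarrow> (\<Prod>i<4. coef N i) = 1"
  shows "t = T \<and> two_fixed_vectors 4 N"
proof -
  note pN = supp_permutes[OF N]
  have perm: "permutation \<sigma>" "permutation (supp N)"
    using M pN by (auto simp: permutation_permutes)
  have "sign \<sigma> * sign (supp N) = 1"
    using sign_compose[OF perm] by (simp add: inv)
  then have sN: "sign (supp N) = sign \<sigma>" using sign_cases[of \<sigma>] by (auto simp: sign_def split: if_splits)
  have ti: "t = 3 \<or> t = 4 \<or> t = 5" using t T by auto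
  \<comment> \<open>An involutive \<open>supp N\<close> equals its inverse \<open>\<sigma>\<close>,
    so \<open>\<sigma>\<close> squares to the identity; for \<open>t = 3\<close> this contradicts
    \<open>t3\<close>.\<close>
  have invol: "\<sigma> = supp N" if "supp N \<circ> supp N = id"
  proof -
    have "\<sigma> = \<sigma> \<circ> (supp N \<circ> supp N)" using that by simp
    also have "\<dots> = supp N" using inv by (simp flip: comp_assoc)
    finally show ?thesis .
  qed
  have t3': False if "t = 3" "supp N \<circ> supp N = id"
    using t3[OF that(1)] invol[OF that(2)] fun_cong[OF that(2), of 0] by simp
  from pN show ?thesis
  proof (cases rule: perm4_cases)
    case id
    then have "\<sigma> = id" using inv by simp
    then show ?thesis using ti t3 t4 sg by auto
  next
    case (trans i j k l)
    note s4 = trans(1) and * = trans(2-)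
    have sq: "supp N \<circ> supp N = id"
      by (rule perm4_eqI[OF s4 permutes_compose[OF pN pN] permutes_id]) (simp_all add: *)
    have "t = 3 \<or> t = 5" using ti sg sN sign_transposition[OF pN s4 *] by auto
    then have "t = 5" "T = 5" using t3' sq t T by auto
    then show ?thesis
      using two_fixed_vectors_transposition[OF N s4 prod *] mult by simp
  next
    case (dtrans i j k l)
    note s4 = dtrans(1) and * = dtrans(2-)
    have "eigenvalue_mult N x \<le> 2"
      unfolding eigenvalue_mult_double_transposition[OF N s4 *] by simp
    then have "T = 4" using mult T by auto
    moreover have "t = 4" using ti sg sN sign_double_transposition[OF pN s4 *] t \<open>T = 4\<close> by auto
    ultimately show ?thesis
      using two_fixed_vectors_double_transposition[OF N s4 prod *] mult by simp
  next
    case (cyc3 i j k l)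
    note s4 = cyc3(1) and * = cyc3(2-)
    have "eigenvalue_mult N x \<le> 2"
      unfolding eigenvalue_mult_3_cycle[OF N s4 *] by simp
    then have "T = 4" using mult T by auto
    moreover have "t = 4" using ti sg sN sign_3_cycle[OF pN s4 *] t \<open>T = 4\<close> by auto
    ultimately show ?thesis
      using two_fixed_vectors_3_cycle[OF N s4 prod *] mult by simp
  next
    case (cyc4 i j k l)
    have "eigenvalue_mult N x \<le> 1"
      unfolding eigenvalue_mult_4_cycle[OF N cyc4] by simp
    then show ?thesis using mult T by auto
  qed
qed

section \<open>Necessity: a nice tuple forces \<open>m dvd 4\<close> and entry products 1\<close>

lemma nice_tuple_imp:
  assumes m: "m > 1" and T: "T = 4 \<or> T = 5" and nice: "nice_tuple 4 (Gmpn m p 4) T As"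
  shows "m dvd 4 \<and> Gmpn m p 4 = Gmpn m m 4"
proof -
  define M where "M = foldr (*) As (1\<^sub>m 4)"
  define N where "N = inv\<^bsub>GL 4\<^esub> M"
  have len: "length As = T" and gen: "generate (GL 4) (set As) = Gmpn m p 4"
    and AW: "\<And>A. A \<in> set As \<Longrightarrow> A \<in> Gmpn m p 4" and refl: "\<And>A. A \<in> set As \<Longrightarrow> is_reflection 4 A"
    using nice by (auto simp: nice_tuple_def)
  obtain x where mult: "eigenvalue_mult N x = T - 2"
    using nice unfolding nice_tuple_def Let_def N_def M_def by blast
  have H: "set As \<subseteq> carrier (GL 4)" using refl by (auto simp: is_reflection_def)
  have mono: "monomial_mat 4 A" if "A \<in> generate (GL 4) (set As)" for A
    using that unfolding gen Gmpn_iff by blast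
  have monoA: "monomial_mat 4 A" if "A \<in> set As" for A
    using AW[OF that] by (simp add: Gmpn_iff)
  have cases: "supp A = id \<or> transposition_reflection A" if "A \<in> set As" for A
    using monoA[OF that] refl[OF that]
  proof (cases rule: reflection_cases)
    case (trans i j k l)
    then show ?thesis unfolding transposition_reflection_def by blast
  qed simp
  have "\<forall>A. \<exists>e. A \<in> set As \<and> supp A \<noteq> id \<longrightarrow> e \<in> edges4 \<and> supp A = transpose (fst e) (snd e)"
  proof
    fix A
    show "\<exists>e. A \<in> set As \<and> supp A \<noteq> id \<longrightarrow> e \<in> edges4 \<and> supp A = transpose (fst e) (snd e)"
    proof (cases "A \<in> set As \<and> supp A \<noteq> id")
      case True
      then have "transposition_reflection A" using cases by blast
      then obtain i j where ij: "i < j" "j < 4" "supp A = transpose i j"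
        using monoA True by (elim transposition_reflectionE) auto
      have "(i, j) \<in> edges4" using ij(1,2) by (auto simp: numeral_eq_Suc less_Suc_eq)
      then show ?thesis using ij(3) by (intro exI[of _ "(i, j)"]) simp
    qed blast
  qed
  from choice[OF this] obtain e where e: "\<And>A. A \<in> set As \<Longrightarrow> supp A \<noteq> id \<Longrightarrow> e A \<in> edges4"
    and eA: "\<And>A. A \<in> set As \<Longrightarrow> supp A \<noteq> id \<Longrightarrow> supp A = transpose (fst (e A)) (snd (e A))"
    by blast
  define Rs where "Rs = filter (\<lambda>A. supp A \<noteq> id) As"
  define es where "es = map e Rs"
  have es: "set es \<subseteq> edges4" unfolding es_def Rs_def set_map set_filter using e by blast
  have conn: "\<exists>e\<in>set es. \<not> unsplit S e" if S: "S \<in> splits4" for S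
  proof -
    obtain A y where A: "A \<in> set As" and y: "(y \<in> set S) \<noteq> (supp A y \<in> set S)"
      using generators_cross_split[OF H gen S] by blast
    then have n: "supp A \<noteq> id" by auto
    have "\<not> unsplit S (e A)" using y unfolding eA[OF A n] by (auto simp: transpose_def split: if_splits)
    moreover have "e A \<in> set es" using A n unfolding es_def Rs_def by simp
    ultimately show ?thesis by blast
  qed
  have "supp M = foldr (\<lambda>A s. s \<circ> supp A) As id"
    unfolding M_def by (rule monomial_foldr(2)[OF monoA])
  also have "\<dots> = edge_word es"
    unfolding es_def Rs_def by (rule foldr_supp_edge_word[OF eA])
  finally have suppM: "supp M = edge_word es" .
  have "fst d \<noteq> snd d" if "d \<in> set es" for d
    using subsetD[OF es that] by auto
  then have sg: "sign (supp M) = (-1) ^ length es" unfolding suppM using edge_word_sign[of es] by blast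
  have mM: "monomial_mat 4 M" unfolding M_def by (rule monomial_foldr(1)[OF monoA])
  have MG: "M \<in> generate (GL 4) (set As)"
  proof -
    have "foldr (*) Bs (1\<^sub>m 4) \<in> generate (GL 4) (set As)" if "set Bs \<subseteq> set As" for Bs
      using that
    proof (induction Bs)
      case Nil
      show ?case using generate.one[of "GL 4" "set As"] by (simp add: GL_simps)
    next
      case (Cons B Bs)
      then show ?case
        using generate.eng[OF generate.incl[of B "set As" "GL 4"], of "foldr (*) Bs (1\<^sub>m 4)"]
        by (simp add: GL_simps)
    qed
    then show ?thesis unfolding M_def by blast
  qed
  have "N \<in> generate (GL 4) (set As)"
    unfolding N_def by (rule group.generate_m_inv_closed[OF group_GL H MG])
  then have mN: "monomial_mat 4 N" by (rule mono)
  have NM: "N * M = 1\<^sub>m 4"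
    unfolding N_def by (rule GL_inv[OF group.generate_in_carrier[OF group_GL H MG]])
  have inv: "supp M \<circ> supp N = id"
    using supp_mult[OF mN mM] unfolding NM supp_one by simp
  \<comment> \<open>As many edges as factors means that the filter drops nothing, so no factor is
    diagonal.\<close>
  have all_refl: "transposition_reflection A" if "length es = T" "A \<in> set As" for A
  proof -
    have "length (filter (\<lambda>A. supp A \<noteq> id) As) = length As" using that(1) len by (simp add: es_def Rs_def)
    then have "supp A \<noteq> id"
      using length_filter_less[OF that(2), of "\<lambda>A. supp A \<noteq> id"] by (cases "supp A = id") simp_all
    then show ?thesis using cases[OF that(2)] by blast
  qed
  have prodN: "(\<Prod>i<4. coef N i) = 1" if "length es = T"
  proof -
    have "(\<Prod>i<4. coef M i) = 1"
    proof -
      have "(\<Prod>i<4. coef M i) = (\<Prod>A\<leftarrow>As. \<Prod>i<4. coef A i)"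
        unfolding M_def by (rule monomial_foldr(4)[OF monoA])
      also have "map (\<lambda>A. \<Prod>i<4. coef A i) As = map (\<lambda>_. 1) As"
        using prod_coef_transposition[OF all_refl[OF that] monoA] by simp
      finally show ?thesis by (simp add: map_replicate_const)
    qed
    moreover have "(\<Prod>i<4. coef (N * M) i) = 1" unfolding NM by (simp add: coef_one)
    ultimately show ?thesis unfolding prod_coef_mult[OF mN mM] by simp
  qed
  have le: "length es \<le> T" unfolding es_def Rs_def length_map len[symmetric] by (rule length_filter_le)
  have "length es = T \<and> two_fixed_vectors 4 N"
  proof (rule perm_cycle_type_constraints[OF T supp_permutes[OF mM] mN inv mult _ le sg])
    show "3 \<le> length es" by (rule connected_edge_words(1)[OF es conn])
    show "supp M (supp M 0) \<noteq> 0" if "length es = 3"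
      unfolding suppM by (rule connected_edge_words(2)[OF es conn that])
    show "supp M \<noteq> id" if "length es = 4"
      unfolding suppM by (rule connected_edge_words(3)[OF es conn that])
  qed (rule prodN)
  then have les: "length es = T" and two: "two_fixed_vectors 4 N" by auto
  note trans = all_refl[OF les]
  obtain v u where vu: "act 4 N v = v" "act 4 N u = u" "\<not> (\<forall>i<4. v i = 0)" "\<not> (\<exists>c. \<forall>i<4. u i = c * v i)"
    using two unfolding two_fixed_vectors_def by blast
  have MN: "M * N = 1\<^sub>m 4"
    by (rule mat_mult_left_right_inverse[OF monomial_carrier[OF mN] monomial_carrier[OF mM] NM])
  have act_M: "act 4 M w = w" if "act 4 N w = w" for w
  proof -
    have "act 4 M w = act 4 M (act 4 N w)" using that by simp
    also have "\<dots> = w" unfolding act_mult[OF mM mN, symmetric] MN by (rule act_one)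
    finally show ?thesis .
  qed
  have "m dvd 4"
  proof (rule ccontr)
    assume "\<not> m dvd 4"
    then obtain z :: complex where z: "z ^ m = 1" "z ^ 4 \<noteq> 1" "z \<noteq> 0"
      using root_of_unity_exists[of m 4] m by auto
    \<comment> \<open>On \<open>m\<close>-th roots of unity this exponent is the negative of 4, so
      it gives the dual of the fourth-power representation while staying a natural number.\<close>
    define k' where "k' = 4 * (m - 1)"
    have kk': "4 + k' = m * 4" unfolding k'_def using m by (simp add: algebra_simps)
    have "z ^ 4 * z ^ k' = 1" unfolding power_add[symmetric] kk' power_mult z(1) by simp
    then have z': "z ^ k' \<noteq> 1" using z(2) by auto
    have nf: "v i = 0" if fixed: "\<And>A. A \<in> set As \<Longrightarrow> act q A v = v" and q: "z ^ q \<noteq> 1" and i: "i < 4"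
      for q v i
    proof (rule Gmpn_nofix[OF _ i _ z(1) q z(3)])
      show "act q A v = v" if "A \<in> Gmpn m p 4" for A
        using act_generate[OF H mono, of q v A] fixed that gen by blast
    qed simp
    have "(\<forall>i<4. v i = 0) \<or> (\<exists>c. \<forall>i<4. u i = c * v i)"
    proof (rule product_fixed_dim_le_1[of As 4 k'])
      show "length As \<le> 5" using len T by auto
      show "coef A y ^ (4 + k') = 1" if "A \<in> set As" for A y
      proof (cases "y < 4")
        case True
        then have "coef A y ^ m = 1" using AW[OF that] by (simp add: Gmpn_iff)
        then show ?thesis unfolding kk' power_mult by simp
      next
        case False
        then show ?thesis using coef_ge[OF monoA[OF that]] by simp
      qed
      show "v i = 0" if "\<And>A. A \<in> set As \<Longrightarrow> act 4 A v = v" "i < 4" for v i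
        by (rule nf[OF that(1) z(2) that(2)])
      show "v i = 0" if "\<And>A. A \<in> set As \<Longrightarrow> act k' A v = v" "i < 4" for v i
        by (rule nf[OF that(1) z' that(2)])
      show "act 4 (foldr (*) As (1\<^sub>m 4)) v = v" "act 4 (foldr (*) As (1\<^sub>m 4)) u = u"
        using act_M[OF vu(1)] act_M[OF vu(2)] unfolding M_def .
    qed (use monoA trans in blast)+
    then show False using vu(3,4) by blast
  qed
  moreover have "Gmpn m p 4 = Gmpn m m 4"
  proof (intro equalityI subsetI)
    fix A assume A: "A \<in> Gmpn m p 4"
    \<comment> \<open>The entry product is 1 on the generators, hence on the whole group, and this
      is the defining condition for \<open>p = m\<close>.\<close>
    then have "(\<Prod>i<4. coef A i) = 1"
      using prod_coef_generate[OF H mono, of A] prod_coef_transposition[OF trans monoA] gen by blast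
    then show "A \<in> Gmpn m m 4" using A m by (simp add: Gmpn_iff)
  next
    fix A assume "A \<in> Gmpn m m 4"
    then show "A \<in> Gmpn m p 4" using m by (simp add: Gmpn_iff)
  qed
  ultimately show ?thesis by blast
qed

section \<open>Existence\<close>

lemma swap_mat_square:
  assumes "i < n" "j < n" "i \<noteq> j" "c \<noteq> 0"
  shows "swap_mat n i j c * swap_mat n i j c = 1\<^sub>m n"
proof -
  note S = monomial_swap_mat[OF assms] supp_swap_mat[OF assms] coef_swap_mat[OF assms]
  show ?thesis
    by (rule monomial_cong[OF monomial_mult(1)[OF S(1,1)] monomial_one])
      (use assms in \<open>auto simp: coef_mult[OF S(1,1)] supp_mult[OF S(1,1)] S(2,3) coef_one supp_one transpose_def\<close>)
qed

text \<open>Conjugation replaces an index and multiplies the parameters; this is how a few swaps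
  yield all of them.\<close>

lemma swap_mat_conj:
  assumes "i < n" "j < n" "k < n" "i \<noteq> j" "j \<noteq> k" "i \<noteq> k" "c \<noteq> 0" "d \<noteq> 0"
  shows "swap_mat n i j c * (swap_mat n j k d * swap_mat n i j c) = swap_mat n i k (c * d)"
proof -
  have cd: "c * d \<noteq> 0" using assms by simp
  note I = monomial_swap_mat[OF assms(1,2,4,7)] supp_swap_mat[OF assms(1,2,4,7)] coef_swap_mat[OF assms(1,2,4,7)]
  note J = monomial_swap_mat[OF assms(2,3,5,8)] supp_swap_mat[OF assms(2,3,5,8)] coef_swap_mat[OF assms(2,3,5,8)]
  note K = monomial_swap_mat[OF assms(1,3,6) cd] supp_swap_mat[OF assms(1,3,6) cd] coef_swap_mat[OF assms(1,3,6) cd]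
  note JI = monomial_mult(1)[OF J(1) I(1)] supp_mult[OF J(1) I(1)] coef_mult[OF J(1) I(1)]
  show ?thesis
    by (rule monomial_cong[OF monomial_mult(1)[OF I(1) JI(1)] K(1)])
      (use assms in \<open>simp_all add: coef_mult[OF I(1) JI(1)] supp_mult[OF I(1) JI(1)] JI(2,3) I(2,3) J(2,3) K(2,3) transpose_def\<close>)
qed

lemma swap_mat_commute:
  assumes "i < n" "j < n" "i \<noteq> j" "c \<noteq> 0"
  shows "swap_mat n j i (1 / c) = swap_mat n i j c"
  using assms unfolding swap_mat_def
  by (auto simp: gpm_def transpose_commute intro!: eq_matI)

text \<open>A swap brings an entry to the diagonal and turns it into 1 at once; being an involution,
  it is undone by multiplying again. The last row has no partner left, and there the entry product 1
  settles the coefficient.\<close>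

lemma Gmpn_subset_closed:
  assumes m: "m > 0" and mult: "\<And>A B. A \<in> H \<Longrightarrow> B \<in> H \<Longrightarrow> A * B \<in> H" and one: "1\<^sub>m n \<in> H"
    and swaps: "\<And>i j c. i < n \<Longrightarrow> j < n \<Longrightarrow> i \<noteq> j \<Longrightarrow> c ^ m = 1 \<Longrightarrow> swap_mat n i j c \<in> H"
  shows "Gmpn m m n \<subseteq> H"
proof -
  \<comment> \<open>Clear the rows from the top by right multiplication with swaps.\<close>
  have "A \<in> H" if "r \<le> n" "A \<in> Gmpn m m n" "\<And>i. i < r \<Longrightarrow> supp A i = i \<and> coef A i = 1" for r A
    using that
  proof (induction r arbitrary: A rule: inc_induct)
    case base
    then have A: "monomial_mat n A" by (simp add: Gmpn_iff)
    have "A = 1\<^sub>m n"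
      by (rule monomial_cong[OF A monomial_one]) (use base in \<open>simp_all add: coef_one supp_one\<close>)
    then show ?case using one by simp
  next
    case (step r)
    note AG = step.prems(1) and fix_r = step.prems(2)
    have A: "monomial_mat n A" and cm: "\<And>i. i < n \<Longrightarrow> coef A i ^ m = 1" and pr: "(\<Prod>i<n. coef A i) = 1"
      using AG m by (auto simp: Gmpn_iff)
    have inj: "supp A x = supp A y \<Longrightarrow> x = y" for x y
      using permutes_inj[OF supp_permutes[OF A]] by (simp add: inj_eq)
    \<comment> \<open>The entry \<open>?c\<close> of row \<open>r\<close> sits in a column
      \<open>?j\<close> beyond \<open>r\<close>. Row \<open>?j\<close> of the swap carries
      \<open>1 / ?c\<close> in column \<open>r\<close>, and earlier rows are untouched.\<close>
    have off: "B \<in> H" if "B \<in> Gmpn m m n" "supp B r \<noteq> r"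
      "\<And>i. i < r \<Longrightarrow> supp B i = i \<and> coef B i = 1" for B
    proof -
      have B: "monomial_mat n B" using that by (simp add: Gmpn_iff)
      have injB: "supp B x = supp B y \<Longrightarrow> x = y" for x y
        using permutes_inj[OF supp_permutes[OF B]] by (simp add: inj_eq)
      let ?j = "supp B r" and ?c = "coef B r"
      have j: "?j < n" using supp_less[OF B] step.hyps by simp
      have "?j \<ge> r"
      proof (rule ccontr)
        assume "\<not> r \<le> ?j"
        then have "supp B ?j = ?j" using that(3)[of ?j] by simp
        then show False using injB[of ?j r] that(2) by simp
      qed
      then have rj: "r < ?j" using that(2) by simp
      have c: "?c ^ m = 1" "?c \<noteq> 0" using that(1) step.hyps coef_nz[OF B] by (auto simp: Gmpn_iff)
      have rn: "r < n" "r \<noteq> ?j" using step.hyps rj by auto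
      define S where "S = swap_mat n r ?j ?c"
      note Sm = monomial_swap_mat[OF rn(1) j rn(2) c(2), folded S_def]
      note Ss = supp_swap_mat[OF rn(1) j rn(2) c(2), folded S_def]
      note Sc = coef_swap_mat[OF rn(1) j rn(2) c(2), folded S_def]
      have SG: "S \<in> Gmpn m m n" unfolding S_def by (rule swap_mat_Gmpn[OF rn(1) j rn(2) c(2,1)])
      have SH: "S \<in> H" unfolding S_def by (rule swaps[OF rn(1) j rn(2) c(1)])
      have SS: "S * S = 1\<^sub>m n" unfolding S_def by (rule swap_mat_square[OF rn(1) j rn(2) c(2)])
      have "supp (B * S) i = i \<and> coef (B * S) i = 1" if "i < Suc r" for i
      proof (cases "i = r")
        case True
        then show ?thesis using c rn by (simp add: supp_mult[OF B Sm] coef_mult[OF B Sm] Ss Sc)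
      next
        case False
        then have "i < r" using that by simp
        then show ?thesis
          using \<open>\<And>i. i < r \<Longrightarrow> supp B i = i \<and> coef B i = 1\<close>[of i] rj
          by (simp add: supp_mult[OF B Sm] coef_mult[OF B Sm] Ss Sc)
      qed
      then have "B * S \<in> H" by (intro step.IH Gmpn_mult that(1) SG)
      then have "(B * S) * S \<in> H" using SH by (rule mult)
      moreover have "(B * S) * S = B"
        using assoc_mult_mat[OF monomial_carrier[OF B] monomial_carrier[OF Sm] monomial_carrier[OF Sm]]
          SS monomial_carrier[OF B] by simp
      ultimately show ?thesis by simp
    qed
    consider "supp A r \<noteq> r" | "supp A r = r" "Suc r < n" | "supp A r = r" "Suc r = n"
      using step.hyps by linarith
    then show ?case
    proof cases
      case 1
      then show ?thesis using off AG fix_r by blast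
    next
      case 2
      \<comment> \<open>An entry already on the diagonal is pushed off it by a plain swap with the
        next index, which reduces the case to \<open>off\<close>.\<close>
      have rn: "r < n" "r \<noteq> Suc r" using step.hyps by auto
      define S where "S = swap_mat n r (Suc r) 1"
      note Sm = monomial_swap_mat[OF rn(1) 2(2) rn(2) one_neq_zero, folded S_def]
      note Ss = supp_swap_mat[OF rn(1) 2(2) rn(2) one_neq_zero, folded S_def]
      note Sc = coef_swap_mat[OF rn(1) 2(2) rn(2) one_neq_zero, folded S_def]
      have SG: "S \<in> Gmpn m m n" unfolding S_def by (rule swap_mat_Gmpn[OF rn(1) 2(2) rn(2)]) simp_all
      have SH: "S \<in> H" unfolding S_def by (rule swaps[OF rn(1) 2(2) rn(2)]) simp
      have SS: "S * S = 1\<^sub>m n" unfolding S_def by (rule swap_mat_square[OF rn(1) 2(2) rn(2)]) simp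
      have "A * S \<in> H"
      proof (rule off)
        show "A * S \<in> Gmpn m m n" by (intro Gmpn_mult AG SG)
        show "supp (A * S) r \<noteq> r" using 2 by (simp add: supp_mult[OF A Sm] Ss)
        show "supp (A * S) i = i \<and> coef (A * S) i = 1" if "i < r" for i
          using fix_r[OF that] that by (simp add: supp_mult[OF A Sm] coef_mult[OF A Sm] Ss Sc)
      qed
      then have "(A * S) * S \<in> H" using SH by (rule mult)
      moreover have "(A * S) * S = A"
        using assoc_mult_mat[OF monomial_carrier[OF A] monomial_carrier[OF Sm] monomial_carrier[OF Sm]]
          SS monomial_carrier[OF A] by simp
      ultimately show ?thesis by simp
    next
      case 3
      have "(\<Prod>i<n. coef A i) = coef A r * (\<Prod>i<r. coef A i)"
        using 3(2) by (simp add: lessThan_Suc flip: 3(2))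
      also have "(\<Prod>i<r. coef A i) = 1" using fix_r by (intro prod.neutral) auto
      finally have "coef A r = 1" using pr by simp
      then have "supp A i = i \<and> coef A i = 1" if "i < Suc r" for i
        using fix_r[of i] that 3(1) by (cases "i = r") auto
      then show ?thesis by (intro step.IH AG)
    qed
  qed
  from this[of 0] show ?thesis by auto
qed

text \<open>Adjacent plain swaps give all plain ones by conjugation, these spread \<open>z\<close>
  to every ordered pair, and a detour over a third index multiplies the parameter by a further
  \<open>z\<close>. The order of the pair matters, since \<open>swap_mat n j i c\<close> is
  \<open>swap_mat n i j (1 / c)\<close>.\<close>

lemma swap_mats_closed:
  assumes mult: "\<And>A B. A \<in> H \<Longrightarrow> B \<in> H \<Longrightarrow> A * B \<in> H" and z: "z \<noteq> 0"
    and H: "swap_mat 4 0 1 z \<in> H" "swap_mat 4 0 1 1 \<in> H" "swap_mat 4 1 2 1 \<in> H" "swap_mat 4 2 3 1 \<in> H"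
    and ij: "i < 4" "j < 4" "i \<noteq> j"
  shows "swap_mat 4 i j (z ^ q) \<in> H"
proof -
  have comp: "swap_mat 4 i k (c * d) \<in> H"
    if "swap_mat 4 i j c \<in> H" "swap_mat 4 j k d \<in> H" "c \<noteq> 0" "d \<noteq> 0"
      "i < 4" "j < 4" "k < 4" "i \<noteq> j" "j \<noteq> k" "i \<noteq> k" for i j k c d
    unfolding swap_mat_conj[OF that(5,6,7,8,9,10,3,4), symmetric]
    by (intro mult that(1,2))
  have sym: "swap_mat 4 j i 1 \<in> H" if "swap_mat 4 i j 1 \<in> H" "i < 4" "j < 4" "i \<noteq> j" for i j
    using swap_mat_commute[of i 4 j 1] that by simp
  have 02: "swap_mat 4 0 2 1 \<in> H" using comp[OF H(2,3)] by simp
  have 13: "swap_mat 4 1 3 1 \<in> H" using comp[OF H(3,4)] by simp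
  have 03: "swap_mat 4 0 3 1 \<in> H" using comp[OF 02 H(4)] by simp
  have lt4: "x = 0 \<or> x = 1 \<or> x = 2 \<or> x = 3" if "x < 4" for x :: nat using that by linarith
  have one: "swap_mat 4 i j 1 \<in> H" if "i < 4" "j < 4" "i \<noteq> j" for i j
    using lt4[OF that(1)] lt4[OF that(2)] that(3)
      H(2-4) 02 13 03 sym[OF H(2)] sym[OF H(3)] sym[OF H(4)] sym[OF 02] sym[OF 13] sym[OF 03]
    by (elim disjE) simp_all
  have 0: "swap_mat 4 0 j z \<in> H" if "j < 4" "j \<noteq> 0" for j
    using comp[OF H(1) one[of 1 j]] H(1) that z by (cases "j = 1") simp_all
  have third: "\<exists>k<4. k \<noteq> i \<and> k \<noteq> j \<and> k \<noteq> 0" for i j :: nat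
  proof -
    have "(1 \<noteq> i \<and> 1 \<noteq> j) \<or> (2 \<noteq> i \<and> 2 \<noteq> j) \<or> (3 \<noteq> i \<and> 3 \<noteq> j)" by linarith
    then show ?thesis by (elim disjE) (rule exI[of _ 1], simp, rule exI[of _ 2], simp, rule exI[of _ 3], simp)
  qed
  have zz: "swap_mat 4 i j z \<in> H" if "i < 4" "j < 4" "i \<noteq> j" "j \<noteq> 0" for i j
  proof (cases "i = 0")
    case False
    then show ?thesis using comp[OF one[of i 0] 0[of j]] that z by simp
  qed (use 0 that in simp)
  have z': "swap_mat 4 i j z \<in> H" if "i < 4" "j < 4" "i \<noteq> j" for i j
  proof (cases "j = 0")
    case True
    obtain k where "k < 4" "k \<noteq> i" "k \<noteq> j" "k \<noteq> 0" using third by blast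
    then show ?thesis using comp[OF zz[of i k] one[of k j]] that z by simp
  qed (use zz that in simp)
  show ?thesis
    using ij
  proof (induction q arbitrary: i j)
    case 0
    then show ?case by (simp add: one)
  next
    case (Suc q)
    obtain k where k: "k < 4" "k \<noteq> i" "k \<noteq> j" using third by blast
    then have "swap_mat 4 i j (z ^ q * z) \<in> H"
      using comp[OF Suc.IH[of i k] z'[of k j]] Suc.prems z by simp
    then show ?case by (simp add: mult.commute)
  qed
qed

lemma complete_to_four:
  assumes "i < 4" "j < 4" "i \<noteq> j"
  obtains k l where "{i, j, k, l} = {..<4::nat}"
proof -
  have "card ({..<4} - {i, j}) = 2" using assms by (simp add: card_Diff_subset)
  then obtain k l where "{..<4} - {i, j} = {k, l}" by (auto simp: card_2_iff)
  then have "{i, j, k, l} = {..<4}" using assms by auto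
  then show ?thesis by (rule that)
qed

lemma eigenvalue_mult_pos:
  assumes "A \<in> carrier_mat n n" "eigenvalue_mult A x > 0"
  shows "eigenvalue A x"
  unfolding eigenvalue_root_char_poly[OF assms(1)] order_root
  using assms(2) by (simp add: eigenvalue_mult_def)

lemma involution_GL:
  assumes "A \<in> carrier_mat n n" "A * A = 1\<^sub>m n"
  shows "A \<in> carrier (GL n)"
  unfolding units_of_carrier Units_def using assms by (auto simp: ring_mat_def)

text \<open>The characteristic polynomial is (X^2 - 1)(X - 1)^2, so -1 is simple and the only
  eigenvalue besides 1.\<close>

lemma swap_mat_reflection:
  assumes ij: "i < 4" "j < 4" "i \<noteq> j" and c: "c \<noteq> 0"
  shows "is_reflection 4 (swap_mat 4 i j c)"
proof -
  let ?S = "swap_mat 4 i j c"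
  note S = monomial_swap_mat[OF ij c] supp_swap_mat[OF ij c] coef_swap_mat[OF ij c]
  note C = monomial_carrier[OF S(1)]
  obtain k l where s: "{i, j, k, l} = {..<4}" using complete_to_four[OF ij] .
  note d = four_distinct[OF s]
  have sup: "supp ?S i = j" "supp ?S j = i" "supp ?S k = k" "supp ?S l = l"
    using d unfolding S(2) by (simp_all add: transpose_def)
  have co: "coef ?S i * coef ?S j = 1" "coef ?S k = 1" "coef ?S l = 1"
    using d c unfolding S(3) by simp_all
  have "poly (monom 1 2 - [:1:]) u = u ^ 2 - 1" "poly [:- 1, 1:] u = u - 1" for u :: complex
    by (simp_all add: poly_monom)
  then have ev: "eigenvalue ?S u \<longleftrightarrow> u ^ 2 = 1 \<or> u = 1" for u
    unfolding eigenvalue_root_char_poly[OF C] char_poly_transposition[OF S(1) s sup] co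
      poly_mult mult_eq_0_iff by (simp only: right_minus_eq disj_assoc disj_absorb)
  have "u ^ 2 = 1 \<and> u \<noteq> 1 \<longleftrightarrow> u = -1" for u :: complex
    unfolding power2_eq_1_iff by auto
  then have "{u. eigenvalue ?S u \<and> u \<noteq> 1} = {-1}" unfolding ev by blast
  moreover have "eigenvalue_mult ?S (-1) = 1"
    unfolding eigenvalue_mult_transposition[OF S(1) s sup] co by simp
  moreover have "?S ^\<^sub>m 2 = 1\<^sub>m 4"
    using swap_mat_square[OF ij c] C by (simp add: numeral_2_eq_2)
  moreover have "?S \<in> carrier (GL 4)"
    by (rule involution_GL[OF C swap_mat_square[OF ij c]])
  ultimately show ?thesis
    unfolding is_reflection_def by (intro conjI exI[of _ 2] exI[of _ "-1"] zero_less_numeral)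
qed

lemma generate_swap_mats:
  assumes m: "m > 0" and z: "z ^ m = 1" and prim: "\<And>c. c ^ m = 1 \<Longrightarrow> \<exists>q. c = z ^ q"
    and swaps: "\<And>A. A \<in> H \<Longrightarrow> \<exists>i j c. i < 4 \<and> j < 4 \<and> i \<noteq> j \<and> c ^ m = 1 \<and> A = swap_mat 4 i j c"
    and H: "swap_mat 4 0 1 z \<in> H" "swap_mat 4 0 1 1 \<in> H" "swap_mat 4 1 2 1 \<in> H" "swap_mat 4 2 3 1 \<in> H"
  shows "generate (GL 4) H = Gmpn m m 4"
proof
  have nz: "c \<noteq> 0" if "c ^ m = 1" for c :: complex using that m by (auto simp: power_0_left)
  show "generate (GL 4) H \<subseteq> Gmpn m m 4"
  proof
    fix A assume "A \<in> generate (GL 4) H"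
    then show "A \<in> Gmpn m m 4"
    proof (induction rule: generate.induct)
      case one
      then show ?case by (simp add: GL_simps one_Gmpn)
    next
      case (incl h)
      obtain i j c where ij: "i < 4" "j < 4" "i \<noteq> j" "c ^ m = 1" and h: "h = swap_mat 4 i j c"
        using swaps[OF incl] by blast
      show ?case unfolding h by (rule swap_mat_Gmpn[OF ij(1-3) nz[OF ij(4)] ij(4)])
    next
      case (inv h)
      obtain i j c where ij: "i < 4" "j < 4" "i \<noteq> j" "c ^ m = 1" and h: "h = swap_mat 4 i j c"
        using swaps[OF inv] by blast
      have sq: "h * h = 1\<^sub>m 4" unfolding h by (rule swap_mat_square[OF ij(1-3) nz[OF ij(4)]])
      have "h \<in> carrier_mat 4 4"
        unfolding h by (rule monomial_carrier[OF monomial_swap_mat[OF ij(1-3) nz[OF ij(4)]]])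
      then have hG: "h \<in> carrier (GL 4)" using sq by (rule involution_GL)
      have "inv\<^bsub>GL 4\<^esub> h = h"
        by (rule group.inv_equality[OF group_GL _ hG hG]) (simp add: GL_simps sq)
      then show ?case
        unfolding h using swap_mat_Gmpn[OF ij(1-3) nz[OF ij(4)] ij(4)] by simp
    next
      case (eng h1 h2)
      then show ?case by (simp add: GL_simps Gmpn_mult)
    qed
  qed
  have mult: "A * B \<in> generate (GL 4) H" if "A \<in> generate (GL 4) H" "B \<in> generate (GL 4) H" for A B
    using generate.eng[OF that] by (simp add: GL_simps)
  show "Gmpn m m 4 \<subseteq> generate (GL 4) H"
  proof (rule Gmpn_subset_closed[OF m mult])
    show "1\<^sub>m 4 \<in> generate (GL 4) H" using generate.one[of "GL 4" H] by (simp add: GL_simps)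
    fix i j :: nat and c :: complex
    assume ij: "i < 4" "j < 4" "i \<noteq> j" and c: "c ^ m = 1"
    obtain q where q: "c = z ^ q" using prim[OF c] by blast
    show "swap_mat 4 i j c \<in> generate (GL 4) H"
      unfolding q by (rule swap_mats_closed[OF mult nz[OF z] H[THEN generate.incl] ij])
  qed
qed

text \<open>Leaves only the eigenvalue to be checked. \<open>mult\<close> describes the inverse
  \<open>N\<close> by two equations that give its rows from those of the product, so no inverse
  matrix has to be written down.\<close>

lemma nice_tuple_swaps:
  assumes m: "m > 0" and z: "z ^ m = 1" and prim: "\<And>c. c ^ m = 1 \<Longrightarrow> \<exists>q. c = z ^ q"
    and swaps: "\<And>A. A \<in> set As \<Longrightarrow> \<exists>i j c. i < 4 \<and> j < 4 \<and> i \<noteq> j \<and> c ^ m = 1 \<and> A = swap_mat 4 i j c"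
    and H: "swap_mat 4 0 1 z \<in> set As" "swap_mat 4 0 1 1 \<in> set As" "swap_mat 4 1 2 1 \<in> set As"
      "swap_mat 4 2 3 1 \<in> set As"
    and len: "length As = T" "T > 2"
    and mult: "\<And>N. monomial_mat 4 N \<Longrightarrow>
       (\<And>y. supp N (supp (foldr (*) As (1\<^sub>m 4)) y) = y) \<Longrightarrow>
       (\<And>y. coef N (supp (foldr (*) As (1\<^sub>m 4)) y) = 1 / coef (foldr (*) As (1\<^sub>m 4)) y) \<Longrightarrow>
       \<exists>l. l \<noteq> 1 \<and> eigenvalue_mult N l = T - 2"
  shows "nice_tuple 4 (Gmpn m m 4) T As"
proof -
  have nz: "c \<noteq> 0" if "c ^ m = 1" for c :: complex using that m by (auto simp: power_0_left)
  define M where "M = foldr (*) As (1\<^sub>m 4)"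
  define N where "N = inv\<^bsub>GL 4\<^esub> M"
  have gen: "generate (GL 4) (set As) = Gmpn m m 4"
    by (rule generate_swap_mats[OF m z prim swaps H])
  have refl: "is_reflection 4 A" if A_in: "A \<in> set As" for A
  proof -
    obtain i j c where ij: "i < 4" "j < 4" "i \<noteq> j" "c ^ m = 1" and A: "A = swap_mat 4 i j c"
      using swaps[OF A_in] by blast
    show ?thesis unfolding A by (rule swap_mat_reflection[OF ij(1-3) nz[OF ij(4)]])
  qed
  have AW: "A \<in> Gmpn m m 4" if "A \<in> set As" for A
    unfolding gen[symmetric] by (rule generate.incl[OF that])
  have MW: "M \<in> Gmpn m m 4"
  proof -
    have "foldr (*) Bs (1\<^sub>m 4) \<in> Gmpn m m 4" if "set Bs \<subseteq> set As" for Bs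
      using that by (induction Bs) (auto intro: Gmpn_mult one_Gmpn AW)
    then show ?thesis unfolding M_def by blast
  qed
  have HG: "set As \<subseteq> carrier (GL 4)" using refl by (auto simp: is_reflection_def)
  have Mgen: "M \<in> generate (GL 4) (set As)" unfolding gen by (rule MW)
  have NM: "N * M = 1\<^sub>m 4"
    unfolding N_def by (rule GL_inv[OF group.generate_in_carrier[OF group_GL HG Mgen]])
  have "N \<in> Gmpn m m 4"
    using group.generate_m_inv_closed[OF group_GL HG Mgen] unfolding gen N_def .
  then have mN: "monomial_mat 4 N" and mM: "monomial_mat 4 M" using MW by (simp_all add: Gmpn_iff)
  have MN: "M * N = 1\<^sub>m 4"
    by (rule mat_mult_left_right_inverse[OF monomial_carrier[OF mN] monomial_carrier[OF mM] NM])
  have sN: "supp N (supp M y) = y" for y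
    using fun_cong[OF supp_mult[OF mM mN], of y] unfolding MN supp_one by simp
  have cN: "coef N (supp M y) = 1 / coef M y" for y
    using coef_mult[OF mM mN, of y] coef_nz[OF mM, of y] unfolding MN coef_one by (simp add: field_simps)
  obtain l where l: "l \<noteq> 1" "eigenvalue_mult N l = T - 2"
    using mult[OF mN] sN cN unfolding M_def by blast
  have "eigenvalue N l"
    by (rule eigenvalue_mult_pos[OF monomial_carrier[OF mN]]) (use l len in simp)
  then have "\<exists>l. l \<noteq> 1 \<and> eigenvalue N l \<and> eigenvalue_mult N l = T - 2" using l by blast
  then show ?thesis unfolding nice_tuple_def Let_def using len(1) AW refl gen
    by (simp only: N_def M_def) blast
qed

section \<open>The two explicit tuples\<close>

lemma swap_mat_times:
  assumes B: "monomial_mat n B" and ij: "i < n" "j < n" "i \<noteq> j" "c \<noteq> 0"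
  shows "monomial_mat n (swap_mat n i j c * B)"
    and "supp (swap_mat n i j c * B) = supp B \<circ> transpose i j"
    and "coef (swap_mat n i j c * B) y = coef (swap_mat n i j c) y * coef B (transpose i j y)"
  using monomial_mult[OF monomial_swap_mat[OF ij] B] unfolding supp_swap_mat[OF ij] by blast+

lemma four_set: "{0, 1, 2, 3} = {..<4::nat}" "{1, 2, 3, 0} = {..<4::nat}" "{2, 3, 0, 1} = {..<4::nat}"
  by auto

context
  fixes m :: nat and z :: complex
  assumes m: "m > 0" and z: "z ^ m = 1" and prim: "\<And>c. c ^ m = 1 \<Longrightarrow> \<exists>q. c = z ^ q"
    and z4: "z ^ 4 = 1" and z1: "z \<noteq> 1"
begin

text \<open>The first two swaps multiply to the diagonal matrix with \<open>z\<close> and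
  \<open>1 / z\<close> in front, the other two to a 3-cycle on 1, 2, 3. The inverse has fixed entry
  \<open>1 / z\<close> and a 3-cycle with entry product \<open>z\<close>; both carry the eigenvalue
  \<open>1 / z\<close>, because its cube is \<open>z\<close> when \<open>z ^ 4 = 1\<close>.\<close>

lemma nice_4_tuple_exists: "\<exists>As. nice_tuple 4 (Gmpn m m 4) 4 As"
proof
  let ?As = "[swap_mat 4 0 1 z, swap_mat 4 0 1 1, swap_mat 4 1 2 1, swap_mat 4 2 3 1]"
  have z0: "z \<noteq> 0" using z4 by auto
  let ?M = "foldr (*) ?As (1\<^sub>m 4)"
  have sM: "supp ?M = transpose 2 3 \<circ> transpose 1 2 \<circ> transpose 0 1 \<circ> transpose 0 1"
    and cM: "coef ?M y = coef (swap_mat 4 0 1 z) y" for y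
    using z0 by (simp_all add: swap_mat_times supp_one coef_one monomial_one comp_assoc coef_swap_mat)
  show "nice_tuple 4 (Gmpn m m 4) 4 ?As"
  proof (rule nice_tuple_swaps[OF m z prim])
    fix N assume N: "monomial_mat 4 N" and s: "\<And>y. supp N (supp ?M y) = y"
      and c: "\<And>y. coef N (supp ?M y) = 1 / coef ?M y"
    have sN: "supp N 1 = 2" "supp N 2 = 3" "supp N 3 = 1" "supp N 0 = 0"
      using s[of 0] s[of 1] s[of 2] s[of 3] unfolding sM by (simp_all add: transpose_def)
    have cN: "coef N 0 = 1 / z" "coef N 1 = 1" "coef N 2 = 1" "coef N 3 = z"
      using c[of 0] c[of 1] c[of 2] c[of 3] z0 unfolding sM cM by (simp_all add: transpose_def coef_swap_mat)
    have "(1 / z) ^ 3 = z" using z4 z0 by (simp add: field_simps power3_eq_cube power4_eq_xxxx)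
    then have "eigenvalue_mult N (1 / z) = 2"
      unfolding eigenvalue_mult_3_cycle[OF N four_set(2) sN] cN by simp
    then show "\<exists>l. l \<noteq> 1 \<and> eigenvalue_mult N l = 4 - 2" using z1 by (intro exI[of _ "1 / z"]) simp
  next
    fix A assume "A \<in> set ?As"
    then consider "A = swap_mat 4 0 1 z" | "A = swap_mat 4 0 1 1" | "A = swap_mat 4 1 2 1" | "A = swap_mat 4 2 3 1"
      by auto
    then show "\<exists>i j c. i < 4 \<and> j < 4 \<and> i \<noteq> j \<and> c ^ m = 1 \<and> A = swap_mat 4 i j c"
    proof cases
      case 1 show ?thesis unfolding 1 by (rule exI[of _ 0], rule exI[of _ 1], rule exI[of _ z]) (simp add: z)
    next
      case 2 show ?thesis unfolding 2 by (rule exI[of _ 0], rule exI[of _ 1], rule exI[of _ 1]) simp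
    next
      case 3 show ?thesis unfolding 3 by (rule exI[of _ 1], rule exI[of _ 2], rule exI[of _ 1]) simp
    next
      case 4 show ?thesis unfolding 4 by (rule exI[of _ 2], rule exI[of _ 3], rule exI[of _ 1]) simp
    qed
  qed simp_all
qed

text \<open>Four of the swaps are those of the 4-tuple and generate the group. The fifth, with
  parameter \<open>z ^ 2\<close>, is fitted so that the inverse has two fixed entries
  \<open>1 / z\<close> and a 2-cycle with entry product \<open>z ^ 2\<close>; by
  \<open>z ^ 4 = 1\<close> all three cycles carry the eigenvalue \<open>1 / z\<close>.\<close>

lemma nice_5_tuple_exists: "\<exists>As. nice_tuple 4 (Gmpn m m 4) 5 As"
proof
  let ?As = "[swap_mat 4 2 3 1, swap_mat 4 0 2 (z ^ 2), swap_mat 4 0 1 1, swap_mat 4 1 2 1, swap_mat 4 0 1 z]"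
  have z0: "z \<noteq> 0" using z4 by auto
  let ?M = "foldr (*) ?As (1\<^sub>m 4)"
  have sM: "supp ?M = transpose 0 1 \<circ> transpose 1 2 \<circ> transpose 0 1 \<circ> transpose 0 2 \<circ> transpose 2 3"
    and cM: "coef ?M y = coef (swap_mat 4 0 2 (z ^ 2)) (transpose 2 3 y) *
      coef (swap_mat 4 0 1 z) (transpose 1 2 (transpose 0 1 (transpose 0 2 (transpose 2 3 y))))" for y
    using z0 by (simp_all add: swap_mat_times supp_one coef_one monomial_one comp_assoc coef_swap_mat)
  show "nice_tuple 4 (Gmpn m m 4) 5 ?As"
  proof (rule nice_tuple_swaps[OF m z prim])
    fix N assume N: "monomial_mat 4 N" and s: "\<And>y. supp N (supp ?M y) = y"
      and c: "\<And>y. coef N (supp ?M y) = 1 / coef ?M y"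
    have sN: "supp N 2 = 3" "supp N 3 = 2" "supp N 0 = 0" "supp N 1 = 1"
      using s[of 0] s[of 1] s[of 2] s[of 3] unfolding sM by (simp_all add: transpose_def)
    have cN: "coef N 0 = 1 / z" "coef N 1 = 1 / z" "coef N 2 = z * z" "coef N 3 = 1"
      using c[of 0] c[of 1] c[of 2] c[of 3] z0 unfolding sM cM
      by (simp_all add: transpose_def coef_swap_mat power2_eq_square field_simps)
    have "(1 / z) ^ 2 = z ^ 4 / z ^ 2" unfolding z4 by (simp add: power_one_over)
    also have "\<dots> = z * z * 1" using z0 by (simp add: power2_eq_square power4_eq_xxxx)
    finally have eq: "(1 / z) ^ 2 = z * z * 1" .
    have "eigenvalue_mult N (1 / z) = 3"
      unfolding eigenvalue_mult_transposition[OF N four_set(3) sN] cN eq by simp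
    then show "\<exists>l. l \<noteq> 1 \<and> eigenvalue_mult N l = 5 - 2" using z1 by (intro exI[of _ "1 / z"]) simp
  next
    have zz: "(z ^ 2) ^ m = 1" using z by (simp flip: power_mult add: mult.commute[of 2])
        (simp add: power_mult)
    fix A assume "A \<in> set ?As"
    then consider "A = swap_mat 4 0 1 z" | "A = swap_mat 4 0 1 1" | "A = swap_mat 4 1 2 1"
      | "A = swap_mat 4 2 3 1" | "A = swap_mat 4 0 2 (z ^ 2)"
      by auto
    then show "\<exists>i j c. i < 4 \<and> j < 4 \<and> i \<noteq> j \<and> c ^ m = 1 \<and> A = swap_mat 4 i j c"
    proof cases
      case 1 show ?thesis unfolding 1 by (rule exI[of _ 0], rule exI[of _ 1], rule exI[of _ z]) (simp add: z)
    next
      case 2 show ?thesis unfolding 2 by (rule exI[of _ 0], rule exI[of _ 1], rule exI[of _ 1]) simp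
    next
      case 3 show ?thesis unfolding 3 by (rule exI[of _ 1], rule exI[of _ 2], rule exI[of _ 1]) simp
    next
      case 4 show ?thesis unfolding 4 by (rule exI[of _ 2], rule exI[of _ 3], rule exI[of _ 1]) simp
    next
      case 5 show ?thesis unfolding 5 by (rule exI[of _ 0], rule exI[of _ 2], rule exI[of _ "z ^ 2"]) (simp add: zz)
    qed
  qed simp_all
qed

end

lemma nice_tuples_G224: "\<exists>As. nice_tuple 4 (Gmpn 2 2 4) 4 As" "\<exists>As. nice_tuple 4 (Gmpn 2 2 4) 5 As"
proof -
  have z: "\<exists>q. c = (- 1) ^ q" if "c ^ 2 = 1" for c :: complex
  proof -
    have "c = (- 1) ^ 0 \<or> c = (- 1) ^ 1" using that by (simp add: power2_eq_1_iff)
    then show ?thesis by blast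
  qed
  show "\<exists>As. nice_tuple 4 (Gmpn 2 2 4) 4 As"
    by (rule nice_4_tuple_exists[OF _ _ z]) simp_all
  show "\<exists>As. nice_tuple 4 (Gmpn 2 2 4) 5 As"
    by (rule nice_5_tuple_exists[OF _ _ z]) simp_all
qed

lemma nice_tuples_G444: "\<exists>As. nice_tuple 4 (Gmpn 4 4 4) 4 As" "\<exists>As. nice_tuple 4 (Gmpn 4 4 4) 5 As"
proof -
  have i4: "\<i> ^ 4 = 1" by (simp add: power4_eq_xxxx)
  have z: "\<exists>q. c = \<i> ^ q" if "c ^ 4 = 1" for c
  proof -
    have "(c - 1) * (c + 1) * (c - \<i>) * (c + \<i>) = c ^ 4 - 1"
      by (simp add: algebra_simps power4_eq_xxxx)
    then have "c = 1 \<or> c = - 1 \<or> c = \<i> \<or> c = - \<i>"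
      using that by (auto simp: eq_neg_iff_add_eq_0)
    then have "c = \<i> ^ 0 \<or> c = \<i> ^ 2 \<or> c = \<i> ^ 1 \<or> c = \<i> ^ 3"
      by (simp add: power3_eq_cube)
    then show ?thesis by blast
  qed
  show "\<exists>As. nice_tuple 4 (Gmpn 4 4 4) 4 As"
    by (rule nice_4_tuple_exists[OF _ i4 z i4]) simp_all
  show "\<exists>As. nice_tuple 4 (Gmpn 4 4 4) 5 As"
    by (rule nice_5_tuple_exists[OF _ i4 z i4]) simp_all
qed

theorem theorem1p6:
  fixes m p :: nat and W :: "complex mat set"
  assumes "m > 1" and "p dvd m" and "W = Gmpn m p 4"
  shows "((\<exists>As. nice_tuple 4 W 4 As) \<longleftrightarrow> W = Gmpn 2 2 4 \<or> W = Gmpn 4 4 4) \<and>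
         ((\<exists>As. nice_tuple 4 W 5 As) \<longleftrightarrow> W = Gmpn 2 2 4 \<or> W = Gmpn 4 4 4)"
proof -
  have m0: "m = 2 \<or> m = 4" if "m dvd 4"
  proof -
    have "m \<le> 4" using that by (rule dvd_imp_le) simp
    then have "m = 2 \<or> m = 3 \<or> m = 4" using assms(1) by linarith
    then show ?thesis using that by auto
  qed
  have nec: "W = Gmpn 2 2 4 \<or> W = Gmpn 4 4 4" if "T = 4 \<or> T = 5" "nice_tuple 4 W T As" for T As
  proof -
    have "m dvd 4 \<and> Gmpn m p 4 = Gmpn m m 4"
      by (rule nice_tuple_imp[OF assms(1) that(1)]) (use that(2) assms(3) in simp)
    then show ?thesis using m0 assms(3) by auto
  qed
  show ?thesis
    using nec[of 4] nec[of 5] nice_tuples_G224 nice_tuples_G444 by blast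
qed

end
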